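(* Let $n\ge 2$. For any (globally) convex curve $\gamma:\mathbb{S}^1\to\mathbb{R}P^{n-1}$ or $\gamma: I\to\mathbb{R}P^{n-1}$, where $I\subseteq\mathbb{R}$ is an interval, one has $$\sharp_\gamma\ \ge\ \frac{n^3-n}{6}.$$
   Context: Curves are smooth and intervals are non-degenerate. A curve $\gamma$ in $\mathbb{R}P^{n-1}$ (defined on $\mathbb{S}^1$ or on an interval) is locally convex if for every hyperplane $H\subset\mathbb{R}P^{n-1}$ the local multiplicity of the intersection of $\gamma$ with $H$ at each intersection point is at most $n-1$; equivalently, for local lifts of $\gamma$ to $\mathbb{R}^n\setminus\{0\}$ the vectors $\gamma(t),\gamma'(t),\dots,\gamma^{(n-1)}(t)$ are linearly independent for every $t$. It is globally convex (or simply convex) if for every hyperplane $H$ the sum of all local multiplicities of intersection of $\gamma$ with $H$ is at most $n-1$. Here the local multiplicity at parameter $t_0$ is the order of vanishing at $t_0$ of $\ell(\tilde\gamma(t))$, where $\tilde\gamma$ is a local lift of $\gamma$ and $\ell$ is a linear form defining $H$. $\mathrm{Fl}_n$ is the space of complete real flags in $\mathbb{R}^n$. Two complete flags $f_1,f_2$ are transversal if for every $1\le i\le n-1$ the $i$-dimensional subspace of $f_1$ and the $(n-i)$-dimensional subspace of $f_2$ intersect only at the origin; otherwise they are non-transversal. For a locally convex curve $\gamma$, its osculating flag curve $\gamma_{\mathcal F}$ takes $t$ to the complete flag whose $i$-dimensional subspace is spanned by $\tilde\gamma(t),\tilde\gamma'(t),\dots,\tilde\gamma^{(i-1)}(t)$.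 For $f\in\mathrm{Fl}_n$, $\sharp_{\gamma,f}$ is the number of parameters $t$ for which $\gamma_{\mathcal F}(t)$ and $f$ are non-transversal, and $\sharp_\gamma=\sup_{f\in\mathrm{Fl}_n}\sharp_{\gamma,f}$. *)

theory Defs
  imports "HOL-Analysis.Analysis"
begin

section \<open>Smooth maps on subsets of the line\<close>

text \<open>Derivatives are taken within \<open>S\<close>, so they are one-sided at endpoints belonging to \<open>S\<close>.\<close>

definition iter_deriv :: "real set \<Rightarrow> nat \<Rightarrow> (real \<Rightarrow> 'a::real_normed_vector) \<Rightarrow> real \<Rightarrow> 'a" where
  "iter_deriv S k g = ((\<lambda>h t. vector_derivative h (at t within S)) ^^ k) g"

definition smooth_map_on :: "real set \<Rightarrow> (real \<Rightarrow> 'a::real_normed_vector) \<Rightarrow> bool" where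
  "smooth_map_on S g \<longleftrightarrow> (\<forall>k. \<forall>t\<in>S. iter_deriv S k g differentiable (at t within S))"

text \<open>The value is \<open>\<infinity>\<close> (the infimum of the empty set) if all derivatives vanish at \<open>t\<close>.\<close>

definition vanishing_order :: "real set \<Rightarrow> (real \<Rightarrow> real) \<Rightarrow> real \<Rightarrow> enat" where
  "vanishing_order S h t = (INF k\<in>{k. iter_deriv S k h t \<noteq> 0}. enat k)"

section \<open>Curves in real projective space\<close>

text \<open>
  Points of \<open>RP\<^sup>n\<^sup>-\<^sup>1\<close>, where \<open>n = CARD('n)\<close>, are the one-dimensional subspaces of \<open>real ^ 'n\<close>.
  A curve \<open>c\<close> is considered on a set \<open>I\<close> of parameters; it is smooth if it has smooth nowhere
  vanishing local lifts.
\<close>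

definition local_lift ::
  "real set \<Rightarrow> (real \<Rightarrow> (real ^ 'n) set) \<Rightarrow> real \<Rightarrow> real set \<Rightarrow> (real \<Rightarrow> real ^ 'n) \<Rightarrow> bool" where
  "local_lift I c t J g \<longleftrightarrow>
     openin (top_of_set I) J \<and> is_interval J \<and> t \<in> J \<and>
     smooth_map_on J g \<and> (\<forall>s\<in>J. g s \<noteq> 0 \<and> c s = span {g s})"

definition smooth_curve :: "real set \<Rightarrow> (real \<Rightarrow> (real ^ 'n) set) \<Rightarrow> bool" where
  "smooth_curve I c \<longleftrightarrow> (\<forall>t\<in>I. \<exists>J g. local_lift I c t J g)"

text \<open>
  Two local lifts differ by a smooth nowhere vanishing factor, so the next notion and the
  osculating flag below do not depend on the lift that \<open>SOME\<close> picks.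
\<close>

definition local_mult ::
  "real set \<Rightarrow> (real \<Rightarrow> (real ^ 'n) set) \<Rightarrow> (real ^ 'n \<Rightarrow> real) \<Rightarrow> real \<Rightarrow> enat" where
  "local_mult I c l t =
     (SOME m. \<exists>J g. local_lift I c t J g \<and> m = vanishing_order J (l \<circ> g) t)"

text \<open>
  In what follows \<open>T \<subseteq> I\<close> is a set of parameters listing each point of the source of the curve
  exactly once. For a curve on an interval \<open>I\<close>, take \<open>T = I\<close>. A curve \<open>\<gamma>\<close> on the unit circle
  is represented by \<open>c = \<gamma> \<circ> cis\<close> with \<open>I = UNIV\<close> and \<open>T = {0..<2*pi}\<close>.
  Hyperplanes are the kernels of the nonzero linear forms \<open>l\<close>; parameters whose image is not on
  the hyperplane contribute \<open>0\<close> to the sum, and every family is summable in \<open>enat\<close>.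
\<close>

definition globally_convex :: "real set \<Rightarrow> real set \<Rightarrow> (real \<Rightarrow> (real ^ 'n) set) \<Rightarrow> bool" where
  "globally_convex I T c \<longleftrightarrow>
     smooth_curve I c \<and>
     (\<forall>l. linear l \<and> (\<exists>x. l x \<noteq> 0) \<longrightarrow> (\<Sum>\<^sub>\<infinity>t\<in>T. local_mult I c l t) \<le> enat (CARD('n) - 1))"

section \<open>Flags\<close>

text \<open>\<open>F i\<close> is the \<open>i\<close>-dimensional subspace; the values for \<open>i > CARD('n)\<close> are irrelevant.\<close>

definition complete_flag :: "(nat \<Rightarrow> (real ^ 'n) set) \<Rightarrow> bool" where
  "complete_flag F \<longleftrightarrow>
     (\<forall>i\<le>CARD('n). subspace (F i) \<and> dim (F i) = i) \<and> (\<forall>i<CARD('n). F i \<subseteq> F (Suc i))"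

definition transversal_flags ::
  "(nat \<Rightarrow> (real ^ 'n) set) \<Rightarrow> (nat \<Rightarrow> (real ^ 'n) set) \<Rightarrow> bool" where
  "transversal_flags F G \<longleftrightarrow> (\<forall>i\<in>{1..CARD('n) - 1}. F i \<inter> G (CARD('n) - i) = {0})"

definition osculating_flag ::
  "real set \<Rightarrow> (real \<Rightarrow> (real ^ 'n) set) \<Rightarrow> real \<Rightarrow> nat \<Rightarrow> (real ^ 'n) set" where
  "osculating_flag I c t i =
     (SOME V. \<exists>J g. local_lift I c t J g \<and> V = span ((\<lambda>k. iter_deriv J k g t) ` {..<i}))"

definition ecard :: "'a set \<Rightarrow> enat" where
  "ecard A = (if finite A then enat (card A) else \<infinity>)"

definition sharp_flag ::
  "real set \<Rightarrow> real set \<Rightarrow> (real \<Rightarrow> (real ^ 'n) set) \<Rightarrow> (nat \<Rightarrow> (real ^ 'n) set) \<Rightarrow> enat" where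
  "sharp_flag I T c F = ecard {t\<in>T. \<not> transversal_flags (osculating_flag I c t) F}"

definition sharp :: "real set \<Rightarrow> real set \<Rightarrow> (real \<Rightarrow> (real ^ 'n) set) \<Rightarrow> enat" where
  "sharp I T c = (SUP F\<in>{F. complete_flag F}. sharp_flag I T c F)"

section \<open>The two kinds of source\<close>

definition convex_curve_interval :: "real set \<Rightarrow> (real \<Rightarrow> (real ^ 'n) set) \<Rightarrow> bool" where
  "convex_curve_interval I \<gamma> \<longleftrightarrow> globally_convex I I \<gamma>"

definition sharp_interval :: "real set \<Rightarrow> (real \<Rightarrow> (real ^ 'n) set) \<Rightarrow> enat" where
  "sharp_interval I \<gamma> = sharp I I \<gamma>"

text \<open>Only the values of \<open>\<gamma>\<close> on the unit circle \<open>sphere 0 1 = range cis\<close> matter.\<close>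

definition convex_curve_circle :: "(complex \<Rightarrow> (real ^ 'n) set) \<Rightarrow> bool" where
  "convex_curve_circle \<gamma> \<longleftrightarrow> globally_convex UNIV {0..<2*pi} (\<gamma> \<circ> cis)"

definition sharp_circle :: "(complex \<Rightarrow> (real ^ 'n) set) \<Rightarrow> enat" where
  "sharp_circle \<gamma> = sharp UNIV {0..<2*pi} (\<gamma> \<circ> cis)"

end

theory Submission
  imports Defs "Jordan_Normal_Form.Determinant"
begin

text \<open>
  The idea is to count non-transversal parameters near a single parameter \<open>t0\<close>, for a flag that is a
  suitable small perturbation of the osculating flag at \<open>t0\<close>. Convexity enters
  through the linear independence of the first \<open>n\<close> derivatives of a lift: a hyperplane containing all of
  them would meet the curve with local multiplicity at least \<open>n\<close> (lemma \<open>convex_curve_jets_span\<close>).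

  In coordinates adapted to the derivatives at \<open>t0\<close>, the curve is
  \<open>(u 0, \<dots>, u (n - 1))\<close> with \<open>u j\<close> asymptotic to \<open>t ^ j\<close>. Give the flag by linear forms
  \<open>p 0, \<dots>, p (n - 1)\<close>: its subspace of dimension \<open>n - i\<close> is the common kernel of the first \<open>i\<close> forms.
  The flag is non-transversal to the osculating flag at every zero of one of the Wronskians
  \<open>W i\<close> of \<open>p 0, \<dots>, p (i - 1)\<close> along the curve, where \<open>0 < i < n\<close>. For the rational normal curve
  \<open>W i\<close> is a polynomial of degree \<open>i * (n - i)\<close>, and the sum of these degrees is \<open>(n ^ 3 - n) / 6\<close>. So
  it suffices to choose the forms such that each \<open>W i\<close> has \<open>i * (n - i)\<close> zeros close to \<open>0\<close>, with no
  zero common to two of the Wronskians.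

  The coefficients of the forms are, up to sign, powers of a small parameter \<open>e\<close>. Their exponents are
  chosen such that at the scale \<open>t = \<kappa> * e ^ d\<close>, where the exponent \<open>d\<close> depends on a row \<open>r < i\<close> and
  a column \<open>j\<close> with \<open>r \<le> j < r + (n - i)\<close>, exactly two terms dominate the expansion of \<open>W i\<close>: all rows but
  \<open>r\<close> occupy the same columns in both, and row \<open>r\<close> takes column \<open>j\<close> in one term and \<open>j + 1\<close> in the
  other (lemma \<open>total_exponent_dominant_minimal\<close>). The two terms have opposite signs, so \<open>W i\<close>
  changes sign where they balance (lemma \<open>flag_wronskian_sign_change\<close>).

  Different pairs \<open>(r, j)\<close> belong to different exponents \<open>d\<close>, so their zeros are well separated. For the
  same pair \<open>(r, j)\<close> and different \<open>i\<close>, the zeros have the same order of magnitude, but the constant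
  \<open>\<kappa>\<close> where the terms balance is a ratio of two Vandermonde determinants, which is explicit and
  strictly increasing in \<open>i\<close> (lemma \<open>root_ratio_strict_mono\<close>). Hence all zeros are distinct
  (lemma \<open>flag_wronskian_many_roots\<close>).

  Since the osculating flag and the multiplicities are defined with an unspecified lift, it remains to
  see that the lift does not matter. A linear form vanishes on the first \<open>i\<close> derivatives of a lift
  \<open>g\<close> at \<open>t\<close> if and only if its value at \<open>g (t + s)\<close> is of smaller order than \<open>s ^ (i - 1)\<close>, and this is
  unaffected by a scalar factor that is bounded near \<open>t\<close> (lemma \<open>local_lifts_same_annihilators\<close>).
\<close>

section \<open>The dominant terms of a determinant expansion\<close>

lemma sum_lessThan_card_le:
  fixes A :: "nat set"
  assumes "finite A"
  shows "\<Sum>{..<card A} \<le> \<Sum>A"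
  using assms
proof (induction "card A" arbitrary: A)
  case 0
  then show ?case by simp
next
  case (Suc m)
  then have ne: "A \<noteq> {}" by auto
  define x where "x = Max A"
  have x: "x \<in> A" "\<And>y. y \<in> A \<Longrightarrow> y \<le> x"
    using Suc.prems ne by (auto simp: x_def)
  have "A \<subseteq> {..x}" using x by auto
  then have "card A \<le> Suc x" by (metis card_atMost card_mono finite_atMost)
  then have "m \<le> x" using Suc.hyps(2) by simp
  moreover have "\<Sum>{..<card (A - {x})} \<le> \<Sum>(A - {x})"
    by (rule Suc.hyps(1)) (use Suc x in auto)
  moreover have "card (A - {x}) = m" using Suc.hyps(2) Suc.prems x by simp
  moreover have "\<Sum>A = x + \<Sum>(A - {x})"
    using Suc.prems x by (simp add: sum.remove)
  ultimately show ?case using Suc.hyps(2)[symmetric] by simp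
qed

text \<open>
  Summation by parts turns the weighted sum into the sum of all initial sums
  \<open>f 0 + \<dots> + f (q - 1)\<close> with \<open>q \<le> m\<close>. Each of these adds \<open>q\<close> distinct natural numbers, so it is least
  for \<open>0 + \<dots> + (q - 1)\<close>; equality for every \<open>q\<close> determines the values of \<open>f\<close> one after the other.
\<close>

lemma weighted_sum_inj:
  fixes f :: "nat \<Rightarrow> nat"
  assumes "inj_on f {..<m}"
  shows "(\<Sum>r<m. (m - r) * r) \<le> (\<Sum>r<m. (m - r) * f r)"
    and "(\<Sum>r<m. (m - r) * f r) = (\<Sum>r<m. (m - r) * r) \<Longrightarrow> r < m \<Longrightarrow> f r = r"
proof -
  have "(\<Sum>r<m. (m - r) * r) \<le> (\<Sum>r<m. (m - r) * f r) \<and>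
        ((\<Sum>r<m. (m - r) * f r) = (\<Sum>r<m. (m - r) * r) \<longrightarrow> (\<forall>r<m. f r = r))"
    using assms
  proof (induction m)
    case 0
    then show ?case by simp
  next
    case (Suc m)
    have split: "(\<Sum>r<Suc m. (Suc m - r) * g r) = (\<Sum>r<m. (m - r) * g r) + (\<Sum>r<Suc m. g r)"
      for g :: "nat \<Rightarrow> nat"
    proof -
      have "(\<Sum>r<Suc m. (Suc m - r) * g r) = (\<Sum>r<Suc m. (m - r) * g r + g r)"
        by (rule sum.cong) (auto simp: Suc_diff_le)
      then show ?thesis by (simp add: sum.distrib)
    qed
    have inj: "inj_on f {..<m}" using Suc.prems by (auto simp: inj_on_def)
    note IH = Suc.IH[OF inj]
    have "\<Sum>{..<card (f ` {..<Suc m})} \<le> \<Sum>(f ` {..<Suc m})"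
      by (rule sum_lessThan_card_le) simp
    then have tri: "(\<Sum>r<Suc m. r) \<le> (\<Sum>r<Suc m. f r)"
      using Suc.prems by (simp add: card_image sum.reindex del: sum.lessThan_Suc)
    show ?case
    proof (intro conjI impI)
      show "(\<Sum>r<Suc m. (Suc m - r) * r) \<le> (\<Sum>r<Suc m. (Suc m - r) * f r)"
        unfolding split using IH tri by linarith
      assume "(\<Sum>r<Suc m. (Suc m - r) * f r) = (\<Sum>r<Suc m. (Suc m - r) * r)"
      then have *: "(\<Sum>r<m. (m - r) * f r) = (\<Sum>r<m. (m - r) * r)"
        "(\<Sum>r<Suc m. f r) = (\<Sum>r<Suc m. r)"
        unfolding split using IH tri by linarith+
      then have "\<forall>r<m. f r = r" using IH by blast
      then show "\<forall>r<Suc m. f r = r" using *(2) by (auto simp: less_Suc_eq)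
    qed
  qed
  then show "(\<Sum>r<m. (m - r) * r) \<le> (\<Sum>r<m. (m - r) * f r)"
    and "(\<Sum>r<m. (m - r) * f r) = (\<Sum>r<m. (m - r) * r) \<Longrightarrow> r < m \<Longrightarrow> f r = r" by auto
qed

text \<open>
  A choice of columns for the \<open>i\<close> rows of a minor: the rows before \<open>r0\<close> take the leftmost of the \<open>n\<close>
  columns, the rows after \<open>r0\<close> the rightmost ones, and row \<open>r0\<close> the column \<open>x\<close> in between.
\<close>

definition dominant :: "nat \<Rightarrow> nat \<Rightarrow> nat \<Rightarrow> nat \<Rightarrow> nat \<Rightarrow> nat" where
  "dominant n i r0 x r = (if r < r0 then r else if r = r0 then x else n - i + r)"

lemma sum_split_at:
  fixes f :: "nat \<Rightarrow> 'a::comm_monoid_add"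
  assumes "r0 < i"
  shows "sum f {..<i} = sum f {..<r0} + (f r0 + sum f {r0<..<i})"
proof -
  have "{..<i} = {..<r0} \<union> ({r0} \<union> {r0<..<i})" using assms by auto
  moreover have "{..<r0} \<inter> ({r0} \<union> {r0<..<i}) = {}" "{r0} \<inter> {r0<..<i} = {}" by auto
  ultimately show ?thesis
    by (metis (no_types, lifting) finite.emptyI finite.insertI finite_UnI finite_greaterThanLessThan
        finite_lessThan sum.insert sum.empty sum.union_disjoint add.right_neutral empty_iff)
qed

text \<open>
  Counting rows and columns backwards brings the block of rows after \<open>r0\<close> into the shape
  treated by \<open>weighted_sum_inj\<close>.
\<close>

lemma sum_upper_reverse:
  assumes "r0 < i" "i \<le> n" "\<And>r. r < i \<Longrightarrow> f r < n"
  shows "(\<Sum>r\<in>{r0<..<i}. (int r0 - int r) * int (f r)) =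
    int (\<Sum>s<i - 1 - r0. (i - 1 - r0 - s) * (n - 1 - f (i - 1 - s)))
      + (\<Sum>r\<in>{r0<..<i}. (int r0 - int r) * (int n - 1))"
proof -
  have "int (\<Sum>s<i - 1 - r0. (i - 1 - r0 - s) * (n - 1 - f (i - 1 - s)))
      = (\<Sum>r\<in>{r0<..<i}. (int r - int r0) * (int n - 1 - int (f r)))"
    unfolding of_nat_sum
  proof (rule sum.reindex_bij_witness[where i = "\<lambda>r. i - 1 - r" and j = "\<lambda>s. i - 1 - s"])
    fix s assume s: "s \<in> {..<i - 1 - r0}"
    have "f (i - 1 - s) < n" using s by (intro assms) auto
    then show "(int (i - 1 - s) - int r0) * (int n - 1 - int (f (i - 1 - s)))
       = int ((i - 1 - r0 - s) * (n - 1 - f (i - 1 - s)))"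
      using s by (simp add: of_nat_diff diff_diff_eq)
  qed auto
  then show ?thesis
    by (simp add: sum.distrib[symmetric] algebra_simps)
qed

text \<open>
  Rows before \<open>r0\<close> have positive weight and want small columns, rows after \<open>r0\<close> have negative
  weight and want large ones. The two blocks can be minimised separately because both optima are
  attained by one and the same injective choice.
\<close>

lemma dominant_minimal:
  assumes i: "r0 < i" "i \<le> n" and f: "\<And>r. r < i \<Longrightarrow> f r < n" "inj_on f {..<i}"
  shows "(\<Sum>r<i. (int r0 - int r) * int (dominant n i r0 x r)) \<le> (\<Sum>r<i. (int r0 - int r) * int (f r))"
    and "(\<Sum>r<i. (int r0 - int r) * int (f r)) = (\<Sum>r<i. (int r0 - int r) * int (dominant n i r0 x r))
      \<Longrightarrow> r < i \<Longrightarrow> f r = dominant n i r0 (f r0) r"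
proof -
  define lo where "lo = (\<lambda>g. \<Sum>r<r0. (r0 - r) * g r :: nat)"
  define hi where "hi = (\<lambda>g. \<Sum>s<i - 1 - r0. (i - 1 - r0 - s) * (n - 1 - g (i - 1 - s)))"
  define c where "c = (\<Sum>r\<in>{r0<..<i}. (int r0 - int r) * (int n - 1))"
  have split: "(\<Sum>r<i. (int r0 - int r) * int (g r)) = int (lo g) + int (hi g) + c"
    if "\<And>r. r < i \<Longrightarrow> r \<noteq> r0 \<Longrightarrow> g r < n" for g
  proof -
    \<comment> \<open>row \<open>r0\<close> has weight \<open>0\<close>, so its column may be changed to one that is certainly less than \<open>n\<close>\<close>
    define g' where "g' = g(r0 := 0)"
    have "(\<Sum>r<i. (int r0 - int r) * int (g r)) = (\<Sum>r<i. (int r0 - int r) * int (g' r))"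
      by (rule sum.cong) (auto simp: g'_def)
    also have "\<dots> = int (lo g') + (\<Sum>r\<in>{r0<..<i}. (int r0 - int r) * int (g' r))"
      unfolding sum_split_at[OF i(1)] lo_def by (simp add: of_nat_diff)
    also have "(\<Sum>r\<in>{r0<..<i}. (int r0 - int r) * int (g' r)) = int (hi g') + c"
      unfolding hi_def c_def by (rule sum_upper_reverse) (use that i in \<open>auto simp: g'_def\<close>)
    also have "lo g' = lo g" unfolding lo_def by (rule sum.cong) (auto simp: g'_def)
    also have "hi g' = hi g" unfolding hi_def by (rule sum.cong) (auto simp: g'_def)
    finally show ?thesis by simp
  qed
  let ?D = "dominant n i r0 x"
  have D: "(\<Sum>r<i. (int r0 - int r) * int (?D r)) = int (lo ?D) + int (hi ?D) + c"
    by (rule split) (use i in \<open>auto simp: dominant_def\<close>)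
  have F: "(\<Sum>r<i. (int r0 - int r) * int (f r)) = int (lo f) + int (hi f) + c"
    by (rule split) (use f in auto)
  have loD: "lo ?D = (\<Sum>r<r0. (r0 - r) * r)"
    unfolding lo_def by (rule sum.cong) (auto simp: dominant_def)
  have hiD: "hi ?D = (\<Sum>s<i - 1 - r0. (i - 1 - r0 - s) * s)"
    unfolding hi_def by (rule sum.cong) (use i in \<open>auto simp: dominant_def\<close>)
  have injlo: "inj_on f {..<r0}" using f(2) i by (auto simp: inj_on_def)
  have injhi: "inj_on (\<lambda>s. n - 1 - f (i - 1 - s)) {..<i - 1 - r0}"
  proof (rule inj_onI)
    fix a b assume ab: "a \<in> {..<i - 1 - r0}" "b \<in> {..<i - 1 - r0}"
      "n - 1 - f (i - 1 - a) = n - 1 - f (i - 1 - b)"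
    have "f (i - 1 - a) < n" "f (i - 1 - b) < n" using ab by (auto intro!: f)
    then have "f (i - 1 - a) = f (i - 1 - b)" using ab by linarith
    then have "i - 1 - a = i - 1 - b" using f(2) ab by (auto simp: inj_on_def)
    then show "a = b" using ab by auto
  qed
  have le: "lo ?D \<le> lo f" "hi ?D \<le> hi f"
    using weighted_sum_inj(1)[OF injlo] weighted_sum_inj(1)[OF injhi] loD hiD
    by (auto simp: lo_def hi_def)
  show "(\<Sum>r<i. (int r0 - int r) * int (?D r)) \<le> (\<Sum>r<i. (int r0 - int r) * int (f r))"
    using D F le by linarith
  assume eq: "(\<Sum>r<i. (int r0 - int r) * int (f r)) = (\<Sum>r<i. (int r0 - int r) * int (?D r))"
    and r: "r < i"
  have eqs: "lo f = lo ?D" "hi f = hi ?D" using eq D F le by linarith+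
  show "f r = dominant n i r0 (f r0) r"
  proof (cases r r0 rule: linorder_cases)
    case less
    then show ?thesis using weighted_sum_inj(2)[OF injlo, of r] eqs(1) loD
      by (simp add: lo_def dominant_def)
  next
    case equal
    then show ?thesis by (simp add: dominant_def)
  next
    case greater
    have "n - 1 - f (i - 1 - (i - 1 - r)) = i - 1 - r"
      by (rule weighted_sum_inj(2)[OF injhi]) (use eqs(2) hiD greater r in \<open>auto simp: hi_def\<close>)
    then have "n - 1 - f r = i - 1 - r" using r greater by simp
    then show ?thesis using f(1)[OF r] greater r i by (simp add: dominant_def)
  qed
qed

text \<open>
  Large enough to outweigh every value of the quadratic part of \<open>weight\<close> summed over a minor.
\<close>

definition gap :: "nat \<Rightarrow> nat" where
  "gap n = n ^ 3 + 1"

text \<open>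
  The exponent of the small parameter in the coefficient of column \<open>j\<close> in row \<open>r\<close>. The second summand
  makes later rows act at much smaller scales; the strictly convex first summand separates the
  columns within a row.
\<close>

definition weight :: "nat \<Rightarrow> nat \<Rightarrow> nat \<Rightarrow> nat" where
  "weight n r j = j * (j - 1) + (r + 1) * gap n * (n - 1 - j)"

text \<open>
  The exponent \<open>d\<close> for which columns \<open>j\<close> and \<open>j + 1\<close> of row \<open>r\<close> balance at \<open>t = e ^ d\<close>, that is, for
  which \<open>weight n r j + d * j = weight n r (j + 1) + d * (j + 1)\<close>.
\<close>

definition root_scale :: "nat \<Rightarrow> nat \<Rightarrow> nat \<Rightarrow> nat" where
  "root_scale n r j = (r + 1) * gap n - 2 * j"

text \<open>
  The power of \<open>e\<close> carried at \<open>t = e ^ root_scale n r0 j0\<close> by the term that uses column \<open>f r\<close> in row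
  \<open>r\<close>.
\<close>

definition total_exponent :: "nat \<Rightarrow> nat \<Rightarrow> nat \<Rightarrow> nat \<Rightarrow> (nat \<Rightarrow> nat) \<Rightarrow> nat" where
  "total_exponent n i r0 j0 f = (\<Sum>r<i. weight n r (f r) + root_scale n r0 j0 * f r)"

lemma gap_gt: "j < n \<Longrightarrow> 2 * j < gap n"
proof -
  assume j: "j < n"
  have "2 * j \<le> n * n" 
  proof (cases "n \<ge> 2")
    case True
    have "2 * j \<le> n * j" using True by simp
    also have "\<dots> \<le> n * n" using j by simp
    finally show ?thesis .
  qed (use j in auto)
  also have "n * n \<le> n ^ 3" using j by (simp add: power3_eq_cube)
  finally show ?thesis by (simp add: gap_def)
qed

lemma root_scale_pos: "j < n \<Longrightarrow> 0 < root_scale n r j"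
  using gap_gt[of j n] by (simp add: root_scale_def)

lemma root_scale_inj:
  assumes "j < n" "j' < n" "root_scale n r j = root_scale n r' j'"
  shows "r = r' \<and> j = j'"
proof -
  have g: "2 * j < gap n" "2 * j' < gap n" using assms gap_gt by auto
  have *: "int (root_scale n a b) = (int a + 1) * int (gap n) - 2 * int b" if "2 * b < gap n" for a b
    using that by (simp add: root_scale_def of_nat_diff algebra_simps)
  have eq: "(int r - int r') * int (gap n) = 2 * (int j - int j')"
    using assms(3) *[OF g(1), of r] *[OF g(2), of r'] by (simp add: algebra_simps)
  have "r = r'"
  proof (rule ccontr)
    assume "r \<noteq> r'"
    then have "1 \<le> \<bar>int r - int r'\<bar>" by linarith
    then have "int (gap n) \<le> \<bar>int r - int r'\<bar> * int (gap n)"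
      by (metis mult_le_cancel_right1 of_nat_less_0_iff)
    also have "\<dots> = \<bar>2 * (int j - int j')\<bar>" using eq by (metis abs_mult abs_of_nat)
    also have "\<dots> < int (gap n)"
      unfolding abs_less_iff using of_nat_less_iff[where 'a=int, THEN iffD2, OF g(1)]
        of_nat_less_iff[where 'a=int, THEN iffD2, OF g(2)] by simp
    finally show False by simp
  qed
  then show ?thesis using eq by simp
qed

text \<open>
  Up to a constant, the exponent is \<open>gap n\<close> times the functional minimised in \<open>dominant_minimal\<close>,
  plus a small remainder, which is nonnegative by \<open>consecutive_product_nonneg\<close>.
\<close>

lemma total_exponent_int:
  assumes "j0 < n" "\<And>r. r < i \<Longrightarrow> f r < n"
  shows "int (total_exponent n i r0 j0 f) =
    (\<Sum>r<i. (int r + 1) * int (gap n) * (int n - 1) - int j0 * (int j0 + 1))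
    + int (gap n) * (\<Sum>r<i. (int r0 - int r) * int (f r))
    + (\<Sum>r<i. (int (f r) - int j0) * (int (f r) - int j0 - 1))"
proof -
  have "2 * j0 < gap n" using assms gap_gt by auto
  then have sc: "int (root_scale n r0 j0) = (int r0 + 1) * int (gap n) - 2 * int j0"
    by (simp add: root_scale_def of_nat_diff algebra_simps)
  have we: "int (weight n r j) = int j * (int j - 1) + (int r + 1) * int (gap n) * (int n - 1 - int j)"
    if "j < n" for r j
  proof -
    have "int (j * (j - 1)) = int j * (int j - 1)" by (cases j) (auto simp: algebra_simps)
    moreover have "int (n - 1 - j) = int n - 1 - int j" using that by linarith
    ultimately show ?thesis unfolding weight_def of_nat_add of_nat_mult by simp
  qed
  show ?thesis
    unfolding total_exponent_def of_nat_sum sum_distrib_left sum.distrib[symmetric]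
  proof (rule sum.cong[OF refl])
    fix r assume "r \<in> {..<i}"
    then have "f r < n" using assms by auto
    then show "int (weight n r (f r) + root_scale n r0 j0 * f r) =
      (int r + 1) * int (gap n) * (int n - 1) - int j0 * (int j0 + 1)
      + int (gap n) * ((int r0 - int r) * int (f r))
      + (int (f r) - int j0) * (int (f r) - int j0 - 1)"
      by (simp add: we sc algebra_simps)
  qed
qed

lemma consecutive_product_nonneg: "0 \<le> (int x - int j) * (int x - int j - 1)"
  by (cases "x \<le> j") (auto intro: mult_nonpos_nonpos mult_nonneg_nonneg)

text \<open>
  Missing the minimum of the main functional costs at least \<open>gap n\<close>, which the remainder cannot
  recover. At the minimum only the column of row \<open>r0\<close> is free, and the remainder contributes the
  product of the consecutive integers \<open>x - j0 - 1\<close> and \<open>x - j0\<close>, which vanishes for exactly two columns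
  \<open>x\<close>.
\<close>

lemma total_exponent_dominant_minimal:
  assumes i: "r0 < i" "i < n" and j: "r0 \<le> j0" "j0 < r0 + (n - i)"
    and f: "\<And>r. r < i \<Longrightarrow> f r < n" "inj_on f {..<i}"
  shows "total_exponent n i r0 j0 (dominant n i r0 j0) \<le> total_exponent n i r0 j0 f"
    and "total_exponent n i r0 j0 f = total_exponent n i r0 j0 (dominant n i r0 j0) \<longleftrightarrow>
      (\<exists>x\<in>{j0, j0 + 1}. \<forall>r<i. f r = dominant n i r0 x r)"
proof -
  let ?D = "dominant n i r0 j0"
  let ?h = "\<lambda>x. (int x - int j0) * (int x - int j0 - 1)"
  let ?S = "\<lambda>g. \<Sum>r<i. (int r0 - int r) * int (g r)"
  let ?H = "\<lambda>g. \<Sum>r<i. ?h (g r)"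
  have jn: "j0 < n" using i j by linarith
  have Dn: "?D r < n" if "r < i" for r using that i j jn by (auto simp: dominant_def)
  have EF: "int (total_exponent n i r0 j0 f) - int (total_exponent n i r0 j0 ?D)
     = int (gap n) * (?S f - ?S ?D) + (?H f - ?H ?D)"
  proof -
    let ?c = "\<Sum>r<i. (int r + 1) * int (gap n) * (int n - 1) - int j0 * (int j0 + 1)"
    have "int (total_exponent n i r0 j0 f) = ?c + int (gap n) * ?S f + ?H f"
      by (rule total_exponent_int[OF jn]) (rule f(1))
    moreover have "int (total_exponent n i r0 j0 ?D) = ?c + int (gap n) * ?S ?D + ?H ?D"
      by (rule total_exponent_int[OF jn]) (rule Dn)
    ultimately show ?thesis unfolding right_diff_distrib by linarith
  qed
  have Sle: "?S ?D \<le> ?S f" by (rule dominant_minimal) (use i f in auto)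
  have Seq: "f r = dominant n i r0 (f r0) r" if "?S f = ?S ?D" "r < i" for r
    using dominant_minimal(2)[of r0 i n f j0 r] i f that by auto
  have Hf: "0 \<le> ?H f" by (intro sum_nonneg consecutive_product_nonneg)
  have HD: "?H ?D \<le> int n ^ 3"
  proof -
    have "?H ?D \<le> (\<Sum>r<i. int n * int n)"
    proof (rule sum_mono)
      fix r assume "r \<in> {..<i}"
      then have "?D r < n" using Dn by auto
      then have a: "\<bar>int (?D r) - int j0\<bar> \<le> int n" "\<bar>int (?D r) - int j0 - 1\<bar> \<le> int n"
        using jn by linarith+
      have "?h (?D r) \<le> \<bar>int (?D r) - int j0\<bar> * \<bar>int (?D r) - int j0 - 1\<bar>"
        by (metis abs_ge_self abs_mult)
      also have "\<dots> \<le> int n * int n" by (intro mult_mono a) auto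
      finally show "?h (?D r) \<le> int n * int n" .
    qed
    also have "\<dots> = int i * (int n * int n)" by simp
    also have "\<dots> \<le> int n * (int n * int n)" using i by (intro mult_right_mono) auto
    finally show ?thesis by (simp add: power3_eq_cube)
  qed
  have big: "total_exponent n i r0 j0 ?D < total_exponent n i r0 j0 f" if "?S f \<noteq> ?S ?D"
  proof -
    have "int (gap n) * 1 \<le> int (gap n) * (?S f - ?S ?D)"
      using that Sle by (intro mult_left_mono) auto
    then have "0 < int (gap n) * (?S f - ?S ?D) + (?H f - ?H ?D)"
      using Hf HD by (simp add: gap_def)
    then show ?thesis using EF by linarith
  qed
  \<comment> \<open>changing the column of row \<open>r0\<close> changes one summand only\<close>
  have Hdom: "?H (dominant n i r0 x) = ?h x + (\<Sum>r\<in>{..<i} - {r0}. ?h (?D r))" for x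
  proof -
    have "?H (dominant n i r0 x) = ?h x + (\<Sum>r\<in>{..<i} - {r0}. ?h (dominant n i r0 x r))"
      using i by (subst sum.remove[of _ r0]) (auto simp: dominant_def)
    also have "(\<Sum>r\<in>{..<i} - {r0}. ?h (dominant n i r0 x r)) = (\<Sum>r\<in>{..<i} - {r0}. ?h (?D r))"
      by (rule sum.cong) (auto simp: dominant_def)
    finally show ?thesis .
  qed
  have small: "int (total_exponent n i r0 j0 f) - int (total_exponent n i r0 j0 ?D) = ?h (f r0)"
    if "?S f = ?S ?D"
  proof -
    have "?H f = ?H (dominant n i r0 (f r0))"
      by (rule sum.cong) (use Seq[OF that] in auto)
    then show ?thesis using EF that Hdom[of "f r0"] Hdom[of j0] by simp
  qed
  have h0: "0 \<le> ?h (f r0)" by (rule consecutive_product_nonneg)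
  show "total_exponent n i r0 j0 ?D \<le> total_exponent n i r0 j0 f"
    using big small h0 by (cases "?S f = ?S ?D") auto
  show "total_exponent n i r0 j0 f = total_exponent n i r0 j0 ?D \<longleftrightarrow>
      (\<exists>x\<in>{j0, j0 + 1}. \<forall>r<i. f r = dominant n i r0 x r)" (is "?l \<longleftrightarrow> ?r")
  proof
    assume ?l
    then have S: "?S f = ?S ?D" using big by auto
    then have "?h (f r0) = 0" using small \<open>?l\<close> by simp
    then have "f r0 \<in> {j0, j0 + 1}" by auto
    then show ?r using Seq[OF S] by blast
  next
    assume ?r
    then obtain x where x: "x \<in> {j0, j0 + 1}" "\<And>r. r < i \<Longrightarrow> f r = dominant n i r0 x r" by blast
    have "?S f = ?S ?D"
      by (rule sum.cong) (use x in \<open>auto simp: dominant_def\<close>)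
    moreover have "f r0 = x" using x(2)[of r0] i by (simp add: dominant_def)
    ultimately show ?l using small x(1) by auto
  qed
qed

section \<open>Vandermonde determinants in falling factorials\<close>

text \<open>
  The factor in \<open>t ^ k\<close> times the \<open>k\<close>-th derivative of \<open>t ^ a\<close>, as a multiple of \<open>t ^ a\<close>.
\<close>

definition falling :: "nat \<Rightarrow> nat \<Rightarrow> real" where
  "falling a k = (\<Prod>m<k. real a - real m)"

definition falling_poly :: "nat \<Rightarrow> real poly" where
  "falling_poly k = (\<Prod>m<k. [:- real m, 1:])"

lemma poly_falling: "poly (falling_poly k) (real a) = falling a k"
  by (simp add: falling_poly_def falling_def poly_prod)

lemma falling_poly_degree: "degree (falling_poly k) = k" "coeff (falling_poly k) k = 1"
proof -
  show deg: "degree (falling_poly k) = k"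
    unfolding falling_poly_def by (subst degree_prod_eq_sum_degree) auto
  have "lead_coeff (falling_poly k) = 1"
    unfolding falling_poly_def lead_coeff_prod by simp
  then show "coeff (falling_poly k) k = 1" by (simp add: deg)
qed

lemma null_vector_of_det_0:
  fixes M :: "nat \<Rightarrow> nat \<Rightarrow> real"
  assumes "det (mat i i (\<lambda>(r, k). M r k)) = 0"
  shows "\<exists>v. (\<exists>k<i. v k \<noteq> 0) \<and> (\<forall>r<i. (\<Sum>k<i. M r k * v k) = 0)"
proof -
  obtain w where w: "w \<in> carrier_vec i" "w \<noteq> 0\<^sub>v i" "mat i i (\<lambda>(r, k). M r k) *\<^sub>v w = 0\<^sub>v i"
    using assms det_0_iff_vec_prod_zero[of "mat i i (\<lambda>(r, k). M r k)" i] by auto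
  show ?thesis
  proof (rule exI[of _ "vec_index w"], intro conjI allI impI)
    show "\<exists>k<i. vec_index w k \<noteq> 0" using w(1,2) by (metis carrier_vecD eq_vecI index_zero_vec)
    fix r assume r: "r < i"
    have "vec_index (mat i i (\<lambda>(r, k). M r k) *\<^sub>v w) r = 0" using w(3) r by simp
    then show "(\<Sum>k<i. M r k * vec_index w k) = 0"
      using r w(1) by (simp add: scalar_prod_def lessThan_atLeast0)
  qed
qed

lemma det_leibniz:
  fixes M :: "nat \<Rightarrow> nat \<Rightarrow> real"
  shows "det (mat i i (\<lambda>(r, k). M r k)) =
    (\<Sum>p | p permutes {..<i}. signof p * (\<Prod>r<i. M r (p r)))"
proof -
  have "det (mat i i (\<lambda>(r, k). M r k)) =
    (\<Sum>p | p permutes {..<i}. signof p * (\<Prod>r<i. mat i i (\<lambda>(r, k). M r k) $$ (r, p r)))"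
    by (subst det_def'[of _ i]) (auto simp: lessThan_atLeast0)
  also have "\<dots> = (\<Sum>p | p permutes {..<i}. signof p * (\<Prod>r<i. M r (p r)))"
  proof (rule sum.cong[OF refl])
    fix p assume "p \<in> {p. p permutes {..<i}}"
    then have "p r < i" if "r < i" for r using that permutes_in_image[of p "{..<i}" r] by auto
    then show "signof p * (\<Prod>r<i. mat i i (\<lambda>(r, k). M r k) $$ (r, p r)) =
       signof p * (\<Prod>r<i. M r (p r))" by (auto intro!: prod.cong)
  qed
  finally show ?thesis .
qed

lemma det_equal_rows:
  fixes M :: "nat \<Rightarrow> nat \<Rightarrow> real"
  assumes "a < i" "b < i" "a \<noteq> b" "\<And>k. k < i \<Longrightarrow> M a k = M b k"
  shows "det (mat i i (\<lambda>(r, k). M r k)) = 0"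
  by (rule det_identical_rows[of _ i a b]) (use assms in \<open>auto intro!: eq_vecI\<close>)

text \<open>
  The Wronskian of the monomials \<open>t ^ x 0, \<dots>, t ^ x (i - 1)\<close> at \<open>t = 1\<close>, a Vandermonde determinant in
  the basis of falling factorials.
\<close>

definition node_det :: "nat \<Rightarrow> (nat \<Rightarrow> nat) \<Rightarrow> real" where
  "node_det i x = det (mat i i (\<lambda>(r, k). falling (x r) k))"

lemma sum_falling_poly_eq_0:
  fixes v :: "nat \<Rightarrow> real"
  assumes "(\<Sum>k<i. Polynomial.smult (v k) (falling_poly k)) = 0" "k < i"
  shows "v k = 0"
  using assms
proof (induction i arbitrary: k)
  case 0
  then show ?case by simp
next
  case (Suc i)
  have "coeff (falling_poly k) i = 0" if "k < i" for k
    using that by (intro coeff_eq_0) (simp add: falling_poly_degree)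
  moreover have "coeff (falling_poly i) i = 1" by (rule falling_poly_degree)
  moreover have "coeff (\<Sum>k<Suc i. Polynomial.smult (v k) (falling_poly k)) i = 0" using Suc.prems by simp
  ultimately have "v i = 0" by (simp add: coeff_sum)
  then show ?case using Suc by (auto simp: less_Suc_eq)
qed

lemma poly_eq_0_of_many_roots:
  fixes p :: "real poly"
  assumes "finite A" "\<And>x. x \<in> A \<Longrightarrow> poly p x = 0" "degree p < card A"
  shows "p = 0"
proof (rule ccontr)
  assume p: "p \<noteq> 0"
  have "card A \<le> card {x. poly p x = 0}"
    using assms by (intro card_mono poly_roots_finite p) auto
  also have "\<dots> \<le> degree p" using p by (rule card_poly_roots_bound)
  finally show False using assms by simp
qed

text \<open>
  A vector in the kernel is the coefficient vector of a polynomial of degree less than \<open>i\<close> that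
  vanishes at the \<open>i\<close> distinct nodes.
\<close>

lemma node_det_nonzero:
  assumes "inj_on x {..<i}"
  shows "node_det i x \<noteq> 0"
proof
  assume "node_det i x = 0"
  then obtain v where v: "\<exists>k<i. v k \<noteq> 0" "\<And>r. r < i \<Longrightarrow> (\<Sum>k<i. falling (x r) k * v k) = 0"
    unfolding node_det_def using null_vector_of_det_0 by blast
  define p where "p = (\<Sum>k<i. Polynomial.smult (v k) (falling_poly k))"
  have "i > 0" using v(1) by auto
  have "p = 0"
  proof (rule poly_eq_0_of_many_roots[of "(\<lambda>r. real (x r)) ` {..<i}"])
    have "inj_on (\<lambda>r. real (x r)) {..<i}" using assms by (auto simp: inj_on_def)
    moreover have "degree p < i"
    proof -
      have "degree p \<le> i - 1" unfolding p_def
        by (rule degree_sum_le) (auto intro!: order.trans[OF degree_smult_le] simp: falling_poly_degree)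
      then show ?thesis using \<open>i > 0\<close> by simp
    qed
    ultimately show "degree p < card ((\<lambda>r. real (x r)) ` {..<i})" by (simp add: card_image)
    show "poly p y = 0" if y: "y \<in> (\<lambda>r. real (x r)) ` {..<i}" for y
    proof -
      obtain r where "y = real (x r)" "r < i" using y by auto
      then show ?thesis using v(2)[of r] by (simp add: p_def poly_sum poly_falling mult.commute)
    qed
  qed simp
  then show False using v(1) sum_falling_poly_eq_0[of v i] by (auto simp: p_def)
qed

text \<open>
  As a function of one node, the determinant is a polynomial of degree less than \<open>i\<close> which
  vanishes at the other \<open>i - 1\<close> nodes. It is thus a multiple of the product of the corresponding linear
  factors, and evaluation at a further point \<open>y\<close> fixes the multiple.
\<close>

lemma node_det_ratio:
  assumes r0: "r0 < i" and inj: "inj_on x {..<i}" and y: "y \<notin> x ` ({..<i} - {r0})"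
  shows "node_det i (x(r0 := z)) * (\<Prod>r\<in>{..<i} - {r0}. real y - real (x r)) =
         node_det i (x(r0 := y)) * (\<Prod>r\<in>{..<i} - {r0}. real z - real (x r))"
proof -
  let ?R = "{..<i} - {r0}"
  define P where "P = (\<Sum>p | p permutes {..<i}.
     Polynomial.smult (signof p * (\<Prod>r\<in>?R. falling (x r) (p r))) (falling_poly (p r0)))"
  have P: "poly P (real a) = node_det i (x(r0 := a))" for a
  proof -
    have "node_det i (x(r0 := a)) =
      (\<Sum>p | p permutes {..<i}. signof p * (\<Prod>r<i. falling ((x(r0 := a)) r) (p r)))"
      unfolding node_det_def by (rule det_leibniz)
    also have "\<dots> = (\<Sum>p | p permutes {..<i}. signof p * (falling a (p r0) * (\<Prod>r\<in>?R. falling (x r) (p r))))"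
    proof (rule sum.cong[OF refl])
      fix p
      have "(\<Prod>r<i. falling ((x(r0 := a)) r) (p r)) =
         falling a (p r0) * (\<Prod>r\<in>?R. falling ((x(r0 := a)) r) (p r))"
        using r0 by (subst prod.remove[of _ r0]) auto
      also have "(\<Prod>r\<in>?R. falling ((x(r0 := a)) r) (p r)) = (\<Prod>r\<in>?R. falling (x r) (p r))"
        by (rule prod.cong) auto
      finally show "signof p * (\<Prod>r<i. falling ((x(r0 := a)) r) (p r)) =
         signof p * (falling a (p r0) * (\<Prod>r\<in>?R. falling (x r) (p r)))" by simp
    qed
    finally show ?thesis by (simp add: P_def poly_sum poly_falling algebra_simps)
  qed
  define Q where "Q = (\<Prod>r\<in>?R. [:- real (x r), 1:])"
  have Q: "poly Q (real a) = (\<Prod>r\<in>?R. real a - real (x r))" for a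
    by (simp add: Q_def poly_prod)
  have dP: "degree P \<le> i - 1" unfolding P_def
  proof (rule degree_sum_le, simp add: finite_permutations)
    fix p assume "p \<in> {p. p permutes {..<i}}"
    then have "p r0 < i" using r0 permutes_in_image[of p "{..<i}" r0] by auto
    then show "degree (Polynomial.smult (signof p * (\<Prod>r\<in>?R. falling (x r) (p r))) (falling_poly (p r0))) \<le> i - 1"
      by (intro order.trans[OF degree_smult_le]) (simp add: falling_poly_degree)
  qed
  have dQ: "degree Q = i - 1" unfolding Q_def
    using r0 by (subst degree_prod_eq_sum_degree) auto
  \<comment> \<open>a polynomial of degree less than \<open>i\<close> with the \<open>i\<close> roots \<open>y\<close> and \<open>x r\<close> for \<open>r \<noteq> r0\<close>\<close>
  define F where "F = Polynomial.smult (poly Q (real y)) P - Polynomial.smult (poly P (real y)) Q"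
  have "F = 0"
  proof (rule poly_eq_0_of_many_roots[of "real ` (insert y (x ` ?R))"])
    have "inj_on x ?R" using inj by (auto simp: inj_on_def)
    then have "card (insert y (x ` ?R)) = i" using y r0 by (simp add: card_image)
    then have "card (real ` (insert y (x ` ?R))) = i" by (subst card_image) auto
    moreover have "degree F \<le> i - 1" unfolding F_def
      by (rule degree_diff_le; rule order.trans[OF degree_smult_le]) (use dP dQ in auto)
    ultimately show "degree F < card (real ` (insert y (x ` ?R)))" using r0 by linarith
    fix w assume "w \<in> real ` (insert y (x ` ?R))"
    then consider "w = real y" | r where "r < i" "r \<noteq> r0" "w = real (x r)" by auto
    then show "poly F w = 0"
    proof cases
      case 1
      then show ?thesis by (simp add: F_def)
    next
      case 2
      have "poly P w = 0" unfolding 2 P node_det_def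
        by (rule det_equal_rows[of r _ r0]) (use 2 r0 in auto)
      moreover have "poly Q w = 0" unfolding 2 Q using 2 by (intro prod_zero) auto
      ultimately show ?thesis by (simp add: F_def)
    qed
  qed simp
  then have "poly F (real z) = 0" by simp
  then show ?thesis by (simp add: F_def P Q algebra_simps)
qed

text \<open>
  The quotient of the two Vandermonde determinants for row \<open>r0\<close> in column \<open>j\<close> and in column \<open>j + 1\<close>.
  The two products belong to the columns occupied by the rows before and after \<open>r0\<close>.
\<close>

definition root_ratio :: "nat \<Rightarrow> nat \<Rightarrow> nat \<Rightarrow> nat \<Rightarrow> real" where
  "root_ratio n i r0 j = (\<Prod>s<r0. (real j - real s) / (real j + 1 - real s)) *
     (\<Prod>s\<in>{n - i + r0 + 1..<n}. (real s - real j) / (real s - real j - 1))"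

lemma root_ratio_pos:
  assumes "r0 \<le> j" "j < r0 + (n - i)"
  shows "0 < root_ratio n i r0 j"
  unfolding root_ratio_def using assms
  by (intro mult_pos_pos prod_pos) auto

text \<open>
  Passing to a larger \<open>i\<close> lets the later rows occupy additional columns on the right of \<open>j + 1\<close>, and
  each of them contributes a factor greater than \<open>1\<close>.
\<close>

lemma root_ratio_strict_mono:
  assumes "r0 < i" "i < i'" "i' < n" "r0 \<le> j" "j < r0 + (n - i')"
  shows "root_ratio n i r0 j < root_ratio n i' r0 j"
proof -
  let ?f = "\<lambda>s. (real s - real j) / (real s - real j - 1)"
  have U: "{n - i' + r0 + 1..<n} = {n - i' + r0 + 1..<n - i + r0 + 1} \<union> {n - i + r0 + 1..<n}"
    using assms by auto
  have "1 < (\<Prod>s\<in>{n - i' + r0 + 1..<n - i + r0 + 1}. ?f s)"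
  proof (rule less_1_prod)
    fix s assume "s \<in> {n - i' + r0 + 1..<n - i + r0 + 1}"
    then have "0 < real s - real j - 1" using assms by auto
    then show "1 < ?f s" by (simp add: divide_simps)
  qed (use assms in auto)
  moreover have "0 < (\<Prod>s\<in>{n - i + r0 + 1..<n}. ?f s)" "0 < (\<Prod>s<r0. (real j - real s) / (real j + 1 - real s))"
    using assms by (auto intro!: prod_pos)
  ultimately show ?thesis unfolding root_ratio_def U
    by (subst prod.union_disjoint) auto
qed

lemma dominant_inj:
  assumes "r0 < i" "i \<le> n" "r0 \<le> x" "x \<le> r0 + (n - i)"
  shows "inj_on (dominant n i r0 x) {..<i}"
  using assms by (auto simp: inj_on_def dominant_def split: if_splits)

lemma node_det_dominant:
  assumes i: "r0 < i" "i < n" and j: "r0 \<le> j" "j < r0 + (n - i)"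
  shows "node_det i (dominant n i r0 j) =
    root_ratio n i r0 j * node_det i (dominant n i r0 (j + 1))"
proof -
  let ?x = "dominant n i r0 j" and ?R = "{..<i} - {r0}"
  have upd: "?x(r0 := a) = dominant n i r0 a" for a by (auto simp: dominant_def)
  have R: "?R = {..<r0} \<union> {r0<..<i}" using i by auto
  have quot: "(\<Prod>r\<in>?R. (real j - real (?x r)) / (real (j + 1) - real (?x r))) = root_ratio n i r0 j"
  proof -
    have "(\<Prod>r\<in>{r0<..<i}. (real j - real (?x r)) / (real (j + 1) - real (?x r))) =
        (\<Prod>s\<in>{n - i + r0 + 1..<n}. (real s - real j) / (real s - real j - 1))"
    proof (rule prod.reindex_bij_witness[where i = "\<lambda>s. s - (n - i)" and j = "\<lambda>r. n - i + r"])
      fix r assume r: "r \<in> {r0<..<i}"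
      have "real (n - i + r) - real j - 1 > 0" using r j by auto
      then show "(real (n - i + r) - real j) / (real (n - i + r) - real j - 1)
        = (real j - real (?x r)) / (real (j + 1) - real (?x r))"
        using r by (simp add: dominant_def divide_simps) (simp add: algebra_simps)
    qed (use i in auto)
    moreover have "(\<Prod>r<r0. (real j - real (?x r)) / (real (j + 1) - real (?x r))) =
      (\<Prod>s<r0. (real j - real s) / (real j + 1 - real s))"
      by (rule prod.cong) (auto simp: dominant_def)
    ultimately show ?thesis unfolding R root_ratio_def
      by (subst prod.union_disjoint) auto
  qed
  have "node_det i (?x(r0 := j)) * (\<Prod>r\<in>?R. real (j + 1) - real (?x r)) =
         node_det i (?x(r0 := j + 1)) * (\<Prod>r\<in>?R. real j - real (?x r))"
  proof (rule node_det_ratio)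
    show "inj_on ?x {..<i}" using i j by (intro dominant_inj) auto
    show "j + 1 \<notin> ?x ` ?R" using j by (auto simp: dominant_def)
  qed (use i in auto)
  moreover have "(\<Prod>r\<in>?R. real (j + 1) - real (?x r)) \<noteq> 0"
    using j by (auto simp: dominant_def)
  ultimately have "node_det i (?x(r0 := j)) = node_det i (?x(r0 := j + 1)) *
     ((\<Prod>r\<in>?R. real j - real (?x r)) / (\<Prod>r\<in>?R. real (j + 1) - real (?x r)))"
    by (simp add: field_simps)
  then show ?thesis unfolding upd prod_dividef[symmetric] quot by simp
qed

section \<open>Wronskians at small scales\<close>

text \<open>
  The alternating signs place the roots on the positive half-line.
\<close>

definition form_coeff :: "nat \<Rightarrow> real \<Rightarrow> nat \<Rightarrow> nat \<Rightarrow> real" where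
  "form_coeff n e r j = (- 1) ^ j * e ^ weight n r j"

text \<open>
  The Wronskian of the first \<open>i\<close> linear forms along the curve; \<open>u j k\<close> is the \<open>k\<close>-th derivative of
  the \<open>j\<close>-th coordinate of the curve.
\<close>

definition flag_wronskian ::
  "nat \<Rightarrow> (nat \<Rightarrow> nat \<Rightarrow> real \<Rightarrow> real) \<Rightarrow> real \<Rightarrow> nat \<Rightarrow> real \<Rightarrow> real" where
  "flag_wronskian n u e i t =
     det (mat i i (\<lambda>(r, k). \<Sum>j<n. form_coeff n e r j * u j k t))"

text \<open>
  The Wronskian of the coordinates selected by \<open>f\<close>, normalised such that it converges as \<open>t\<close> tends to
  \<open>0\<close> when \<open>u j 0\<close> behaves like \<open>t ^ j\<close>.
\<close>

definition scaled_minor ::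
  "(nat \<Rightarrow> nat \<Rightarrow> real \<Rightarrow> real) \<Rightarrow> nat \<Rightarrow> (nat \<Rightarrow> nat) \<Rightarrow> real \<Rightarrow> real" where
  "scaled_minor u i f t = det (mat i i (\<lambda>(r, k). t ^ k * u (f r) k t / t ^ f r))"

text \<open>
  Multilinearity in the rows, together with the bookkeeping of powers of \<open>t\<close>: column \<open>k\<close> of the
  determinant absorbs the factor \<open>t ^ k\<close>.
\<close>

lemma flag_wronskian_expand:
  assumes t: "t \<noteq> 0"
  shows "t ^ (\<Sum>k<i. k) * flag_wronskian n u e i t =
    (\<Sum>f\<in>{..<i} \<rightarrow>\<^sub>E {..<n}. (\<Prod>r<i. form_coeff n e r (f r)) * t ^ (\<Sum>r<i. f r) * scaled_minor u i f t)"
proof -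
  let ?P = "{p. p permutes {..<i}}" and ?F = "{..<i} \<rightarrow>\<^sub>E {..<n}"
  let ?c = "form_coeff n e"
  have "t ^ (\<Sum>k<i. k) * flag_wronskian n u e i t =
     (\<Sum>p\<in>?P. \<Sum>f\<in>?F. t ^ (\<Sum>k<i. k) * (signof p * (\<Prod>r<i. ?c r (f r) * u (f r) (p r) t)))"
    unfolding flag_wronskian_def det_leibniz
    by (simp add: prod_sum_PiE sum_distrib_left)
  also have "\<dots> = (\<Sum>p\<in>?P. \<Sum>f\<in>?F. (\<Prod>r<i. ?c r (f r)) * t ^ (\<Sum>r<i. f r) *
       (signof p * (\<Prod>r<i. t ^ p r * u (f r) (p r) t / t ^ f r)))"
  proof (intro sum.cong refl)
    fix p f assume "p \<in> ?P"
    then have "p permutes {..<i}" by simp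
    then have "(\<Sum>k<i. k) = (\<Sum>r<i. p r)" using sum.permute[of p "{..<i}" "\<lambda>k. k"] by (simp add: o_def)
    then have "t ^ (\<Sum>k<i. k) = (\<Prod>r<i. t ^ p r)" by (simp add: power_sum)
    moreover have "(\<Prod>r<i. t ^ f r) \<noteq> 0" using t by simp
    ultimately show "t ^ (\<Sum>k<i. k) * (signof p * (\<Prod>r<i. ?c r (f r) * u (f r) (p r) t)) =
       (\<Prod>r<i. ?c r (f r)) * t ^ (\<Sum>r<i. f r) *
       (signof p * (\<Prod>r<i. t ^ p r * u (f r) (p r) t / t ^ f r))"
      using t by (simp add: power_sum prod.distrib prod_dividef)
  qed
  also have "\<dots> = (\<Sum>f\<in>?F. \<Sum>p\<in>?P. (\<Prod>r<i. ?c r (f r)) * t ^ (\<Sum>r<i. f r) *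
       (signof p * (\<Prod>r<i. t ^ p r * u (f r) (p r) t / t ^ f r)))"
    by (rule sum.swap)
  finally show ?thesis
    unfolding scaled_minor_def det_leibniz by (simp add: sum_distrib_left)
qed

lemma form_coeff_at_root_scale:
  "(\<Prod>r<i. form_coeff n e r (f r)) * (\<kappa> * e ^ root_scale n r0 j0) ^ (\<Sum>r<i. f r) =
    (- \<kappa>) ^ (\<Sum>r<i. f r) * e ^ total_exponent n i r0 j0 f"
proof -
  have "(\<Prod>r<i. form_coeff n e r (f r)) * (\<kappa> * e ^ root_scale n r0 j0) ^ (\<Sum>r<i. f r) =
    (\<Prod>r<i. form_coeff n e r (f r) * (\<kappa> * e ^ root_scale n r0 j0) ^ f r)"
    by (simp add: power_sum prod.distrib)
  also have "\<dots> = (\<Prod>r<i. (- \<kappa>) ^ f r * e ^ (weight n r (f r) + root_scale n r0 j0 * f r))"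
    by (rule prod.cong) (auto simp: form_coeff_def power_add power_mult power_mult_distrib
        power_minus[of \<kappa>])
  finally show ?thesis by (simp add: power_sum prod.distrib total_exponent_def)
qed

lemma monomial_tendsto_0:
  assumes "\<kappa> > 0" "d > 0"
  shows "filterlim (\<lambda>e::real. \<kappa> * e ^ d) (at_right 0) (at_right 0)"
proof -
  have "((\<lambda>e::real. \<kappa> * e ^ d) \<longlongrightarrow> \<kappa> * 0 ^ d) (at_right 0)"
    by (intro tendsto_intros)
  then have "((\<lambda>e::real. \<kappa> * e ^ d) \<longlongrightarrow> 0) (at_right 0)" using assms by (simp add: zero_power)
  moreover have "\<forall>\<^sub>F e in at_right (0::real). \<kappa> * e ^ d \<in> {0<..} \<and> \<kappa> * e ^ d \<noteq> 0"
    by (rule eventually_mono[OF eventually_at_right_less]) (use assms in simp)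
  ultimately show ?thesis
    by (simp only: filterlim_at)
qed

lemma scaled_minor_tendsto:
  assumes lim: "\<And>j k. j < n \<Longrightarrow> k < n \<Longrightarrow> ((\<lambda>t. t ^ k * u j k t / t ^ j) \<longlongrightarrow> falling j k) (at_right 0)"
    and "i \<le> n" "\<And>r. r < i \<Longrightarrow> f r < n"
  shows "(scaled_minor u i f \<longlongrightarrow> node_det i f) (at_right 0)"
proof -
  have "((\<lambda>t. \<Sum>p | p permutes {..<i}. signof p * (\<Prod>r<i. t ^ p r * u (f r) (p r) t / t ^ f r)) \<longlongrightarrow>
     (\<Sum>p | p permutes {..<i}. signof p * (\<Prod>r<i. falling (f r) (p r)))) (at_right 0)"
  proof (intro tendsto_sum tendsto_mult tendsto_const tendsto_prod lim)
    fix p r assume "p \<in> {p. p permutes {..<i}}" "r \<in> {..<i}"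
    then show "p r < n" "f r < n" using assms permutes_in_image[of p "{..<i}" r] by auto
  qed
  then show ?thesis
    unfolding node_det_def det_leibniz scaled_minor_def[abs_def] .
qed

text \<open>
  After division by the smallest power of \<open>e\<close> only the two dominant terms survive. They come from
  \<open>dominant\<close> with \<open>j0\<close> and \<open>j0 + 1\<close>; the second has one more factor \<open>- \<kappa>\<close>, and the quotient of their
  determinants is \<open>root_ratio\<close>. Terms that use a column twice have two equal rows and vanish.
\<close>

lemma flag_wronskian_limit:
  assumes lim: "\<And>j k. j < n \<Longrightarrow> k < n \<Longrightarrow> ((\<lambda>t. t ^ k * u j k t / t ^ j) \<longlongrightarrow> falling j k) (at_right 0)"
    and i: "r0 < i" "i < n" and j: "r0 \<le> j0" "j0 < r0 + (n - i)" and \<kappa>: "\<kappa> > 0"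
  defines "d \<equiv> root_scale n r0 j0" and "M \<equiv> total_exponent n i r0 j0 (dominant n i r0 j0)"
    and "s \<equiv> (\<Sum>r<i. dominant n i r0 j0 r)"
  shows "((\<lambda>e. (\<kappa> * e ^ d) ^ (\<Sum>k<i. k) * flag_wronskian n u e i (\<kappa> * e ^ d) / e ^ M) \<longlongrightarrow>
     (- \<kappa>) ^ s * ((root_ratio n i r0 j0 - \<kappa>) * node_det i (dominant n i r0 (j0 + 1)))) (at_right 0)"
proof -
  let ?F = "{..<i} \<rightarrow>\<^sub>E {..<n}"
  let ?E = "total_exponent n i r0 j0"
  let ?D = "\<lambda>x. restrict (dominant n i r0 x) {..<i}"
  define g where "g f = (- \<kappa>) ^ (\<Sum>r<i. f r) * node_det i f" for f
  have d: "d > 0" unfolding d_def using i j by (intro root_scale_pos) linarith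
  have Fn: "f r < n" if "f \<in> ?F" "r < i" for f r using that by auto
  have term_limit: "((\<lambda>e. (- \<kappa>) ^ (\<Sum>r<i. f r) * (e ^ ?E f / e ^ M) * scaled_minor u i f (\<kappa> * e ^ d)) \<longlongrightarrow>
      (if inj_on f {..<i} \<and> ?E f = M then g f else 0)) (at_right 0)" if f: "f \<in> ?F" for f
  proof (cases "inj_on f {..<i}")
    case False
    then obtain a b where ab: "a < i" "b < i" "a \<noteq> b" "f a = f b" by (auto simp: inj_on_def)
    have "scaled_minor u i f t = 0" for t
      unfolding scaled_minor_def by (rule det_equal_rows[of a _ b]) (use ab in auto)
    then show ?thesis using False by simp
  next
    case True
    have le: "M \<le> ?E f" unfolding M_def
      by (rule total_exponent_dominant_minimal) (use i j True Fn[OF f] in auto)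
    have "((\<lambda>e::real. e ^ ?E f / e ^ M) \<longlongrightarrow> (if ?E f = M then 1 else 0)) (at_right 0)"
    proof (rule Lim_transform_eventually)
      show "\<forall>\<^sub>F e in at_right (0::real). e ^ (?E f - M) = e ^ ?E f / e ^ M"
        by (rule eventually_mono[OF eventually_at_right_less]) (use le in \<open>simp add: power_diff\<close>)
      have "((\<lambda>e::real. e ^ (?E f - M)) \<longlongrightarrow> 0 ^ (?E f - M)) (at_right 0)" by (intro tendsto_intros)
      then show "((\<lambda>e::real. e ^ (?E f - M)) \<longlongrightarrow> (if ?E f = M then 1 else 0)) (at_right 0)"
        using le by (auto simp: power_0_left split: if_splits)
    qed
    moreover have "((\<lambda>e. scaled_minor u i f (\<kappa> * e ^ d)) \<longlongrightarrow> node_det i f) (at_right 0)"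
      by (rule filterlim_compose[OF scaled_minor_tendsto[OF lim] monomial_tendsto_0])
        (use i \<kappa> d Fn[OF f] in auto)
    ultimately have "((\<lambda>e. (- \<kappa>) ^ (\<Sum>r<i. f r) * (e ^ ?E f / e ^ M) * scaled_minor u i f (\<kappa> * e ^ d)) \<longlongrightarrow>
       (- \<kappa>) ^ (\<Sum>r<i. f r) * (if ?E f = M then 1 else 0) * node_det i f) (at_right 0)"
      by (intro tendsto_intros)
    then show ?thesis using True by (auto simp: g_def split: if_splits)
  qed
  have ev: "\<forall>\<^sub>F e in at_right 0. (\<Sum>f\<in>?F. (- \<kappa>) ^ (\<Sum>r<i. f r) * (e ^ ?E f / e ^ M) * scaled_minor u i f (\<kappa> * e ^ d))
     = (\<kappa> * e ^ d) ^ (\<Sum>k<i. k) * flag_wronskian n u e i (\<kappa> * e ^ d) / e ^ M"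
  proof (rule eventually_mono[OF eventually_at_right_less])
    fix e :: real assume "0 < e"
    then have "\<kappa> * e ^ d \<noteq> 0" using \<kappa> by simp
    then show "(\<Sum>f\<in>?F. (- \<kappa>) ^ (\<Sum>r<i. f r) * (e ^ ?E f / e ^ M) * scaled_minor u i f (\<kappa> * e ^ d))
     = (\<kappa> * e ^ d) ^ (\<Sum>k<i. k) * flag_wronskian n u e i (\<kappa> * e ^ d) / e ^ M"
      by (simp add: flag_wronskian_expand d_def form_coeff_at_root_scale sum_divide_distrib)
  qed
  have D: "?D x \<in> ?F" "inj_on (?D x) {..<i}" "?E (?D x) = M" if "x \<in> {j0, j0 + 1}" for x
  proof -
    show F: "?D x \<in> ?F" using that i j by (auto simp: dominant_def)
    have "inj_on (dominant n i r0 x) {..<i}" using that i j by (intro dominant_inj) auto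
    then show inj: "inj_on (?D x) {..<i}" by (auto simp: inj_on_def)
    have "(\<exists>y\<in>{j0, j0 + 1}. \<forall>r<i. ?D x r = dominant n i r0 y r)" using that by force
    then show "?E (?D x) = M" unfolding M_def
      using total_exponent_dominant_minimal(2)[of r0 i n j0 "?D x"] i j inj Fn[OF F] by auto
  qed
  have "{f \<in> ?F. inj_on f {..<i} \<and> ?E f = M} = {?D j0, ?D (j0 + 1)}"
  proof
    show "{?D j0, ?D (j0 + 1)} \<subseteq> {f \<in> ?F. inj_on f {..<i} \<and> ?E f = M}" using D by blast
    show "{f \<in> ?F. inj_on f {..<i} \<and> ?E f = M} \<subseteq> {?D j0, ?D (j0 + 1)}"
    proof
      fix f assume f: "f \<in> {f \<in> ?F. inj_on f {..<i} \<and> ?E f = M}"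
      then have fF: "f \<in> ?F" by simp
      have "\<exists>x\<in>{j0, j0 + 1}. \<forall>r<i. f r = dominant n i r0 x r"
        using total_exponent_dominant_minimal(2)[of r0 i n j0 f] i j f Fn[OF fF]
        unfolding M_def by auto
      then obtain x where x: "x \<in> {j0, j0 + 1}" "\<forall>r<i. f r = dominant n i r0 x r" by blast
      have "f = ?D x" using fF x(2) by (intro PiE_ext[of f "{..<i}" "\<lambda>_. {..<n}"]) (use D(1)[OF x(1)] in auto)
      then show "f \<in> {?D j0, ?D (j0 + 1)}" using x(1) by auto
    qed
  qed
  moreover have "?D j0 \<noteq> ?D (j0 + 1)"
  proof
    assume "?D j0 = ?D (j0 + 1)"
    then have "?D j0 r0 = ?D (j0 + 1) r0" by simp
    then show False using i by (simp add: dominant_def)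
  qed
  moreover have "finite ?F" by (intro finite_PiE) auto
  ultimately have sum_g: "(\<Sum>f\<in>?F. if inj_on f {..<i} \<and> ?E f = M then g f else 0) = g (?D j0) + g (?D (j0 + 1))"
    by (subst sum.inter_filter[symmetric]) auto
  have g_D: "g (?D x) = g (dominant n i r0 x)" for x
  proof -
    have "mat i i (\<lambda>(r, k). falling (?D x r) k) = mat i i (\<lambda>(r, k). falling (dominant n i r0 x r) k)"
      by (rule eq_matI) auto
    then show ?thesis unfolding g_def node_det_def by simp
  qed
  have sum_D: "(\<Sum>r<i. dominant n i r0 (j0 + 1) r) = Suc s"
  proof -
    have *: "(\<Sum>r<i. dominant n i r0 x r) = x + (\<Sum>r\<in>{..<i} - {r0}. dominant n i r0 j0 r)" for x
      by (subst sum.remove[of _ r0]) (use i in \<open>auto simp: dominant_def intro!: sum.cong split: if_splits\<close>)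
    show ?thesis unfolding s_def *[of "j0 + 1"] *[of j0] by simp
  qed
  have "g (?D j0) + g (?D (j0 + 1)) =
     (- \<kappa>) ^ s * (root_ratio n i r0 j0 * node_det i (dominant n i r0 (j0 + 1)))
     + (- \<kappa>) ^ Suc s * node_det i (dominant n i r0 (j0 + 1))"
    unfolding g_D unfolding g_def sum_D s_def[symmetric] node_det_dominant[OF i j] ..
  also have "\<dots> = (- \<kappa>) ^ s * ((root_ratio n i r0 j0 - \<kappa>) * node_det i (dominant n i r0 (j0 + 1)))"
    by (simp add: algebra_simps)
  finally have "(\<Sum>f\<in>?F. if inj_on f {..<i} \<and> ?E f = M then g f else 0) =
     (- \<kappa>) ^ s * ((root_ratio n i r0 j0 - \<kappa>) * node_det i (dominant n i r0 (j0 + 1)))"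
    unfolding sum_g .
  moreover have "((\<lambda>e. \<Sum>f\<in>?F. (- \<kappa>) ^ (\<Sum>r<i. f r) * (e ^ ?E f / e ^ M) * scaled_minor u i f (\<kappa> * e ^ d)) \<longlongrightarrow>
     (\<Sum>f\<in>?F. if inj_on f {..<i} \<and> ?E f = M then g f else 0)) (at_right 0)"
    by (intro tendsto_sum term_limit)
  ultimately show ?thesis using Lim_transform_eventually[OF _ ev] by simp
qed

lemma flag_wronskian_sign_change:
  assumes lim: "\<And>j k. j < n \<Longrightarrow> k < n \<Longrightarrow> ((\<lambda>t. t ^ k * u j k t / t ^ j) \<longlongrightarrow> falling j k) (at_right 0)"
    and i: "r0 < i" "i < n" and j: "r0 \<le> j0" "j0 < r0 + (n - i)"
    and \<kappa>: "0 < \<kappa>1" "\<kappa>1 < root_ratio n i r0 j0" "root_ratio n i r0 j0 < \<kappa>2"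
  shows "\<forall>\<^sub>F e in at_right 0. flag_wronskian n u e i (\<kappa>1 * e ^ root_scale n r0 j0) *
     flag_wronskian n u e i (\<kappa>2 * e ^ root_scale n r0 j0) < 0"
proof -
  let ?d = "root_scale n r0 j0" and ?M = "total_exponent n i r0 j0 (dominant n i r0 j0)"
  let ?s = "\<Sum>r<i. dominant n i r0 j0 r" and ?C = "node_det i (dominant n i r0 (j0 + 1))"
  let ?W = "\<lambda>\<kappa> e. (\<kappa> * e ^ ?d) ^ (\<Sum>k<i. k) * flag_wronskian n u e i (\<kappa> * e ^ ?d) / e ^ ?M"
  let ?L = "\<lambda>\<kappa>. (- \<kappa>) ^ ?s * ((root_ratio n i r0 j0 - \<kappa>) * ?C)"
  have \<kappa>2: "\<kappa>2 > 0" using \<kappa> by linarith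
  have "((\<lambda>e. ?W \<kappa>1 e * ?W \<kappa>2 e) \<longlongrightarrow> ?L \<kappa>1 * ?L \<kappa>2) (at_right 0)"
    by (intro tendsto_mult flag_wronskian_limit lim i j \<kappa> \<kappa>2)
  moreover have "?L \<kappa>1 * ?L \<kappa>2 < 0"
  proof -
    have C: "?C \<noteq> 0" by (intro node_det_nonzero dominant_inj) (use i j in auto)
    have "?L \<kappa>1 * ?L \<kappa>2 = ((\<kappa>1 * \<kappa>2) ^ ?s * ?C\<^sup>2) * ((root_ratio n i r0 j0 - \<kappa>1) * (root_ratio n i r0 j0 - \<kappa>2))"
      by (simp add: power_mult_distrib[symmetric] power2_eq_square mult_ac)
    moreover have "(\<kappa>1 * \<kappa>2) ^ ?s * ?C\<^sup>2 > 0" using \<kappa> \<kappa>2 C by simp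
    moreover have "(root_ratio n i r0 j0 - \<kappa>1) * (root_ratio n i r0 j0 - \<kappa>2) < 0"
      using \<kappa> by (intro mult_pos_neg) auto
    ultimately show ?thesis by (metis mult_pos_neg)
  qed
  ultimately have "\<forall>\<^sub>F e in at_right 0. ?W \<kappa>1 e * ?W \<kappa>2 e < 0" by (rule order_tendstoD(2))
  then show ?thesis
  proof (rule eventually_elim2[OF _ eventually_at_right_less])
    fix e :: real assume W: "?W \<kappa>1 e * ?W \<kappa>2 e < 0" and e: "0 < e"
    have "(\<kappa>1 * e ^ ?d) ^ (\<Sum>k<i. k) / e ^ ?M * ((\<kappa>2 * e ^ ?d) ^ (\<Sum>k<i. k) / e ^ ?M) > 0"
      using e \<kappa> \<kappa>2 by simp
    moreover have "?W \<kappa>1 e * ?W \<kappa>2 e = (\<kappa>1 * e ^ ?d) ^ (\<Sum>k<i. k) / e ^ ?M * ((\<kappa>2 * e ^ ?d) ^ (\<Sum>k<i. k) / e ^ ?M)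
      * (flag_wronskian n u e i (\<kappa>1 * e ^ ?d) * flag_wronskian n u e i (\<kappa>2 * e ^ ?d))"
      by simp
    ultimately show "flag_wronskian n u e i (\<kappa>1 * e ^ ?d) * flag_wronskian n u e i (\<kappa>2 * e ^ ?d) < 0"
      using W by (metis zero_less_mult_pos not_less_iff_gr_or_eq mult_less_0_iff)
  qed
qed

section \<open>Counting the roots\<close>

lemma flag_wronskian_continuous_on:
  assumes "\<And>j k. j < n \<Longrightarrow> k < n \<Longrightarrow> continuous_on S (u j k)" "i \<le> n"
  shows "continuous_on S (flag_wronskian n u e i)"
proof -
  have "continuous_on S (\<lambda>t. \<Sum>p | p permutes {..<i}.
     signof p * (\<Prod>r<i. \<Sum>j<n. form_coeff n e r j * u j (p r) t))"
  proof (intro continuous_on_sum continuous_on_mult continuous_on_const continuous_on_prod assms(1))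
    fix p r j assume "p \<in> {p. p permutes {..<i}}" "r \<in> {..<i}" "j \<in> {..<n}"
    then show "j < n" "p r < n" using assms(2) permutes_in_image[of p "{..<i}" r] by auto
  qed
  then show ?thesis unfolding flag_wronskian_def[abs_def] det_leibniz .
qed

text \<open>
  A triple \<open>(i, r, q)\<close> names the root of the \<open>i\<close>-th Wronskian that belongs to row \<open>r\<close> and column
  \<open>r + q\<close>.
\<close>

definition root_index :: "nat \<Rightarrow> (nat \<times> nat \<times> nat) set" where
  "root_index n = (SIGMA i:{1..<n}. {..<i} \<times> {..<n - i})"

lemma finite_root_index: "finite (root_index n)"
  unfolding root_index_def by auto

lemma card_root_index: "6 * card (root_index n) + n = n ^ 3"
proof -
  have c: "card (root_index n) = (\<Sum>i<n. i * (n - i))"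
  proof -
    have "card (root_index n) = (\<Sum>i\<in>{1..<n}. i * (n - i))"
      unfolding root_index_def by (simp add: card_cartesian_product)
    also have "\<dots> = (\<Sum>i<n. i * (n - i))" by (rule sum.mono_neutral_left) auto
    finally show ?thesis .
  qed
  have "6 * (\<Sum>i<n. i * (n - i)) + n = n ^ 3"
  proof (induction n)
    case (Suc n)
    have "(\<Sum>i<n. i * (Suc n - i)) = (\<Sum>i<n. i * (n - i) + i)"
      by (rule sum.cong) (auto simp: Suc_diff_le)
    then have "(\<Sum>i<Suc n. i * (Suc n - i)) = (\<Sum>i<n. i * (n - i)) + (\<Sum>i<n. i) + n"
      by (simp add: sum.distrib)
    moreover have "2 * (\<Sum>i<n. i) + n = n * n" by (induction n) auto
    moreover have "Suc n ^ 3 = n ^ 3 + 3 * (n * n) + 3 * n + 1" by (simp add: power3_eq_cube algebra_simps)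
    ultimately show ?case using Suc by linarith
  qed simp
  then show ?thesis by (simp add: c)
qed

lemma separating_margin:
  fixes K :: "'a \<Rightarrow> real"
  assumes "finite Z"
  shows "\<exists>\<delta>. 0 < \<delta> \<and> \<delta> < 1 \<and> (\<forall>z\<in>Z. \<forall>z'\<in>Z. K z < K z' \<longrightarrow> K z * (1 + \<delta>) < K z' * (1 - \<delta>))"
proof -
  have "\<forall>\<^sub>F \<delta> in at_right 0. K z < K z' \<longrightarrow> K z * (1 + \<delta>) < K z' * (1 - \<delta>)" for z z'
  proof (cases "K z < K z'")
    case True
    have "((\<lambda>\<delta>::real. K z' * (1 - \<delta>) - K z * (1 + \<delta>)) \<longlongrightarrow> K z' * (1 - 0) - K z * (1 + 0)) (at_right 0)"
      by (intro tendsto_intros)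
    then have "\<forall>\<^sub>F \<delta> in at_right 0. 0 < K z' * (1 - \<delta>) - K z * (1 + \<delta>)"
      by (rule order_tendstoD(1)) (use True in simp)
    then show ?thesis by (rule eventually_mono) simp
  qed simp
  then have "\<forall>\<^sub>F \<delta> in at_right 0. \<forall>z\<in>Z. \<forall>z'\<in>Z. K z < K z' \<longrightarrow> K z * (1 + \<delta>) < K z' * (1 - \<delta>)"
    by (intro eventually_ball_finite assms ballI) auto
  moreover have "\<forall>\<^sub>F \<delta> in at_right (0::real). \<delta> \<in> {0<..<1}" by (rule eventually_at_right_real) simp
  ultimately have "\<forall>\<^sub>F \<delta> in at_right (0::real). \<delta> \<in> {0<..<1} \<and>
     (\<forall>z\<in>Z. \<forall>z'\<in>Z. K z < K z' \<longrightarrow> K z * (1 + \<delta>) < K z' * (1 - \<delta>))" by eventually_elim auto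
  from eventually_happens'[OF trivial_limit_at_right_real this]
  show ?thesis by auto
qed

lemma eventually_scales_separated:
  fixes a b :: real
  assumes "0 < b" "d < d'"
  shows "\<forall>\<^sub>F e in at_right 0. a * e ^ d' < b * e ^ d"
proof -
  have "((\<lambda>e::real. a * e ^ (d' - d)) \<longlongrightarrow> a * 0 ^ (d' - d)) (at_right 0)" by (intro tendsto_intros)
  then have "\<forall>\<^sub>F e in at_right 0. a * e ^ (d' - d) < b"
    by (rule order_tendstoD(2)) (use assms in \<open>simp add: zero_power\<close>)
  then show ?thesis
  proof (rule eventually_elim2[OF _ eventually_at_right_less])
    fix e :: real assume "a * e ^ (d' - d) < b" "0 < e"
    then have "a * e ^ (d' - d) * e ^ d < b * e ^ d" by simp
    then show "a * e ^ d' < b * e ^ d" using assms by (simp add: mult.assoc power_add[symmetric])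
  qed
qed

text \<open>
  Each triple in \<open>root_index n\<close> yields an interval with a sign change. Two intervals are disjoint
  for small \<open>e\<close>: either their scales have different exponents, or the triples differ in \<open>i\<close> only and
  the strict monotonicity of \<open>root_ratio\<close> applies.
\<close>

lemma flag_wronskian_many_roots:
  assumes lim: "\<And>j k. j < n \<Longrightarrow> k < n \<Longrightarrow> ((\<lambda>t. t ^ k * u j k t / t ^ j) \<longlongrightarrow> falling j k) (at_right 0)"
    and cont: "\<And>j k. j < n \<Longrightarrow> k < n \<Longrightarrow> continuous_on {0<..<\<rho>} (u j k)"
    and \<rho>: "0 < \<rho>"
  shows "\<exists>e T. 0 < e \<and> e < 1 \<and> T \<subseteq> {0<..<\<rho>} \<and> finite T \<and> 6 * card T + n = n ^ 3 \<and>
     (\<forall>t\<in>T. \<exists>i\<in>{1..<n}. flag_wronskian n u e i t = 0)"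
proof -
  let ?Z = "root_index n"
  define K where "K = (\<lambda>(i, r, q). root_ratio n i r (r + q))"
  define d where "d = (\<lambda>(i :: nat, r, q). root_scale n r (r + q))"
  have Z: "fst z \<in> {1..<n}" "fst (snd z) < fst z" "snd (snd z) < n - fst z" if "z \<in> ?Z" for z
    using that by (auto simp: root_index_def)
  have Kpos: "K z > 0" if "z \<in> ?Z" for z
    using Z[OF that] by (auto simp: K_def case_prod_beta intro!: root_ratio_pos)
  \<comment> \<open>equal exponents force equal rows and columns, so the two triples belong to different \<open>i\<close>\<close>
  have Kdiff: "K z \<noteq> K z'" if z: "z \<in> ?Z" "z' \<in> ?Z" "z \<noteq> z'" "d z = d z'" for z z'
  proof -
    obtain i r q i' r' q' where zz: "z = (i, r, q)" "z' = (i', r', q')" by (metis prod.exhaust)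
    have "r + q < n" "r' + q' < n" using Z[OF z(1)] Z[OF z(2)] by (auto simp: zz)
    then have "r = r' \<and> r + q = r' + q'" by (rule root_scale_inj) (use z(4) in \<open>simp add: d_def zz\<close>)
    then have eq: "r' = r" "q' = q" by auto
    then have "i < i' \<or> i' < i" using z(3) zz by auto
    then show ?thesis
    proof
      assume "i < i'"
      then have "root_ratio n i r (r + q) < root_ratio n i' r (r + q)"
        by (intro root_ratio_strict_mono) (use Z[OF z(1)] Z[OF z(2)] zz eq in auto)
      then show ?thesis by (simp add: K_def zz eq)
    next
      assume "i' < i"
      then have "root_ratio n i' r (r + q) < root_ratio n i r (r + q)"
        by (intro root_ratio_strict_mono) (use Z[OF z(1)] Z[OF z(2)] zz eq in auto)
      then show ?thesis by (simp add: K_def zz eq)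
    qed
  qed
  obtain \<delta> where \<delta>: "0 < \<delta>" "\<delta> < 1"
    "\<And>z z'. z \<in> ?Z \<Longrightarrow> z' \<in> ?Z \<Longrightarrow> K z < K z' \<Longrightarrow> K z * (1 + \<delta>) < K z' * (1 - \<delta>)"
    using separating_margin[OF finite_root_index, of n K] by blast
  define lo where "lo z e = K z * (1 - \<delta>) * e ^ d z" for z and e :: real
  define hi where "hi z e = K z * (1 + \<delta>) * e ^ d z" for z and e :: real
  have ev_sep: "\<forall>\<^sub>F e in at_right 0. \<forall>z\<in>?Z. \<forall>z'\<in>?Z. z \<noteq> z' \<longrightarrow> hi z e < lo z' e \<or> hi z' e < lo z e"
  proof (intro eventually_ball_finite finite_root_index ballI)
    fix z z' assume z: "z \<in> ?Z" "z' \<in> ?Z"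
    have pos: "0 < K z * (1 - \<delta>)" "0 < K z' * (1 - \<delta>)" using z \<delta> Kpos by auto
    consider "z = z'" | "z \<noteq> z'" "d z = d z'" | "d z < d z'" | "d z' < d z" by linarith
    then show "\<forall>\<^sub>F e in at_right 0. z \<noteq> z' \<longrightarrow> hi z e < lo z' e \<or> hi z' e < lo z e"
    proof cases
      case 2
      then have "K z < K z' \<or> K z' < K z" using Kdiff[OF z 2] by linarith
      then have *: "K z * (1 + \<delta>) < K z' * (1 - \<delta>) \<or> K z' * (1 + \<delta>) < K z * (1 - \<delta>)"
        using \<delta>(3) z by blast
      have "hi z e < lo z' e \<or> hi z' e < lo z e" if "0 < e" for e
      proof -
        have "0 < e ^ d z'" using that by simp
        then show ?thesis
          using mult_strict_right_mono[of "K z * (1 + \<delta>)" "K z' * (1 - \<delta>)" "e ^ d z'"]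
            mult_strict_right_mono[of "K z' * (1 + \<delta>)" "K z * (1 - \<delta>)" "e ^ d z'"] *
          unfolding hi_def lo_def 2(2) by blast
      qed
      then show ?thesis by (intro eventually_mono[OF eventually_at_right_less]) auto
    next
      case 3
      then show ?thesis using eventually_scales_separated[OF pos(1) 3, of "K z' * (1 + \<delta>)"]
        by (auto simp: hi_def lo_def elim: eventually_mono)
    next
      case 4
      then show ?thesis using eventually_scales_separated[OF pos(2) 4, of "K z * (1 + \<delta>)"]
        by (auto simp: hi_def lo_def elim: eventually_mono)
    qed simp
  qed
  have ev_root: "\<forall>\<^sub>F e in at_right 0. \<forall>z\<in>?Z. flag_wronskian n u e (fst z) (lo z e) * flag_wronskian n u e (fst z) (hi z e) < 0"
  proof (intro eventually_ball_finite finite_root_index ballI)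
    fix z assume z: "z \<in> ?Z"
    obtain i r q where zz: "z = (i, r, q)" by (metis prod.exhaust)
    have "\<forall>\<^sub>F e in at_right 0. flag_wronskian n u e i (K z * (1 - \<delta>) * e ^ root_scale n r (r + q)) *
     flag_wronskian n u e i (K z * (1 + \<delta>) * e ^ root_scale n r (r + q)) < 0"
      by (rule flag_wronskian_sign_change[OF lim])
        (use Z[OF z] Kpos[OF z] \<delta>(1,2) in \<open>auto simp: zz K_def\<close>)
    then show "\<forall>\<^sub>F e in at_right 0. flag_wronskian n u e (fst z) (lo z e) * flag_wronskian n u e (fst z) (hi z e) < 0"
      by (simp add: lo_def hi_def zz d_def)
  qed
  have ev_small: "\<forall>\<^sub>F e in at_right 0. \<forall>z\<in>?Z. hi z e < \<rho>"
  proof (intro eventually_ball_finite finite_root_index ballI)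
    fix z assume z: "z \<in> ?Z"
    have "d z > 0" using Z[OF z] by (auto simp: d_def case_prod_beta intro!: root_scale_pos)
    then show "\<forall>\<^sub>F e in at_right 0. hi z e < \<rho>"
      using eventually_scales_separated[OF \<rho>, of 0 "d z" "K z * (1 + \<delta>)"] by (simp add: hi_def)
  qed
  have "\<forall>\<^sub>F e in at_right (0::real). e \<in> {0<..<1}" by (rule eventually_at_right_real) simp
  with ev_sep ev_root ev_small have "\<forall>\<^sub>F e in at_right 0. e \<in> {0<..<1} \<and>
      (\<forall>z\<in>?Z. \<forall>z'\<in>?Z. z \<noteq> z' \<longrightarrow> hi z e < lo z' e \<or> hi z' e < lo z e) \<and>
      (\<forall>z\<in>?Z. flag_wronskian n u e (fst z) (lo z e) * flag_wronskian n u e (fst z) (hi z e) < 0) \<and>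
      (\<forall>z\<in>?Z. hi z e < \<rho>)" by eventually_elim auto
  from eventually_happens'[OF trivial_limit_at_right_real this]
  obtain e where e: "e \<in> {0<..<1}"
      "\<forall>z\<in>?Z. \<forall>z'\<in>?Z. z \<noteq> z' \<longrightarrow> hi z e < lo z' e \<or> hi z' e < lo z e"
      "\<forall>z\<in>?Z. flag_wronskian n u e (fst z) (lo z e) * flag_wronskian n u e (fst z) (hi z e) < 0"
      "\<forall>z\<in>?Z. hi z e < \<rho>"
    by (elim exE conjE) (rule that)
  have e01: "0 < e" "e < 1" using e(1) by auto
  have "\<forall>z\<in>?Z. \<exists>t. lo z e \<le> t \<and> t \<le> hi z e \<and> flag_wronskian n u e (fst z) t = 0"
  proof
    fix z assume z: "z \<in> ?Z"
    let ?W = "flag_wronskian n u e (fst z)"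
    have "0 < lo z e" "lo z e \<le> hi z e" using Kpos[OF z] \<delta> e01 by (auto simp: lo_def hi_def)
    then have sub: "{lo z e..hi z e} \<subseteq> {0<..<\<rho>}" using bspec[OF e(4) z] by auto
    have cW: "continuous_on {lo z e..hi z e} ?W"
      by (rule continuous_on_subset[OF flag_wronskian_continuous_on sub]) (use cont Z[OF z] in auto)
    have "?W (lo z e) < 0 \<and> 0 < ?W (hi z e) \<or> 0 < ?W (lo z e) \<and> ?W (hi z e) < 0"
      using bspec[OF e(3) z] by (auto simp: mult_less_0_iff)
    then show "\<exists>t. lo z e \<le> t \<and> t \<le> hi z e \<and> ?W t = 0"
      using IVT'[of ?W "lo z e" 0 "hi z e"] IVT2'[of ?W "hi z e" 0 "lo z e"] cW \<open>lo z e \<le> hi z e\<close>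
      by (meson less_imp_le)
  qed
  then obtain \<tau> where \<tau>: "\<And>z. z \<in> ?Z \<Longrightarrow> lo z e \<le> \<tau> z \<and> \<tau> z \<le> hi z e \<and> flag_wronskian n u e (fst z) (\<tau> z) = 0"
    by metis
  have "inj_on \<tau> ?Z"
  proof (rule inj_onI, rule ccontr)
    fix z z' assume z: "z \<in> ?Z" "z' \<in> ?Z" "\<tau> z = \<tau> z'" "z \<noteq> z'"
    then show False using \<tau>[OF z(1)] \<tau>[OF z(2)] bspec[OF bspec[OF e(2) z(1)] z(2)] z(4) by linarith
  qed
  then have "card (\<tau> ` ?Z) = card ?Z" by (rule card_image)
  moreover have "\<tau> z \<in> {0<..<\<rho>}" if "z \<in> ?Z" for z
  proof -
    have "0 < lo z e" using Kpos[OF that] \<delta> e01 by (auto simp: lo_def)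
    then show ?thesis using \<tau>[OF that] bspec[OF e(4) that] by auto
  qed
  moreover have "\<exists>i\<in>{1..<n}. flag_wronskian n u e i (\<tau> z) = 0" if "z \<in> ?Z" for z
    using \<tau>[OF that] Z(1)[OF that] by blast
  ultimately show ?thesis using e01 card_root_index[of n] finite_root_index[of n]
    by (intro exI[of _ e] exI[of _ "\<tau> ` ?Z"]) auto
qed

section \<open>Derivatives of lifts and the osculating flag\<close>

lemma iter_deriv_Suc:
  "iter_deriv S (Suc k) g t = vector_derivative (iter_deriv S k g) (at t within S)"
  by (simp add: iter_deriv_def)

lemma iter_deriv_0: "iter_deriv S 0 g = g"
  by (simp add: iter_deriv_def)

lemma smooth_map_on_has_vector_derivative:
  assumes "smooth_map_on J g" "t \<in> interior J"
  shows "(iter_deriv J k g has_vector_derivative iter_deriv J (Suc k) g t) (at t)"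
proof -
  have "iter_deriv J k g differentiable (at t within J)"
    using assms interior_subset by (auto simp: smooth_map_on_def)
  then show ?thesis
    unfolding iter_deriv_Suc at_within_interior[OF assms(2)] by (simp add: vector_derivative_works)
qed

lemma iter_deriv_linear_comp:
  fixes g :: "real \<Rightarrow> 'a::euclidean_space" and l :: "'a \<Rightarrow> real"
  assumes "smooth_map_on J g" "linear l" "t \<in> interior J"
  shows "iter_deriv J k (l \<circ> g) t = l (iter_deriv J k g t)"
  using assms(3)
proof (induction k arbitrary: t)
  case 0
  then show ?case by (simp add: iter_deriv_0)
next
  case (Suc k)
  have "((\<lambda>s. l (iter_deriv J k g s)) has_vector_derivative l (iter_deriv J (Suc k) g t)) (at t)"
    by (rule bounded_linear.has_vector_derivative[OF linear_conv_bounded_linear[THEN iffD1, OF assms(2)]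
        smooth_map_on_has_vector_derivative[OF assms(1) Suc.prems]])
  then have "(iter_deriv J k (l \<circ> g) has_vector_derivative l (iter_deriv J (Suc k) g t)) (at t)"
    by (rule has_vector_derivative_transform_within_open[OF _ open_interior Suc.prems])
      (simp add: Suc.IH)
  then have "vector_derivative (iter_deriv J k (l \<circ> g)) (at t) = l (iter_deriv J (Suc k) g t)"
    by (rule vector_derivative_at)
  then show ?case unfolding iter_deriv_Suc[of J k "l \<circ> g"] at_within_interior[OF Suc.prems] .
qed

lemma taylor_quotient_limit:
  fixes D :: "nat \<Rightarrow> real \<Rightarrow> real"
  assumes \<rho>: "0 < \<rho>"
    and deriv: "\<And>k s. 0 \<le> s \<Longrightarrow> s < \<rho> \<Longrightarrow> (D k has_real_derivative D (Suc k) s) (at s)"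
    and zero: "\<And>k. k < m \<Longrightarrow> D k 0 = 0"
  shows "((\<lambda>s. D 0 s / s ^ m) \<longlongrightarrow> D m 0 / fact m) (at_right 0)"
proof -
  \<comment> \<open>Taylor's formula with the Lagrange remainder, where all terms before the remainder vanish\<close>
  have "\<exists>\<xi>. 0 < \<xi> \<and> \<xi> \<le> h \<and> D 0 h / h ^ m = D m \<xi> / fact m" if h: "h \<in> {0<..<\<rho>}" for h
  proof -
    obtain \<xi> where \<xi>: "0 < \<xi>" "\<xi> \<le> h"
      "D 0 h = (\<Sum>k<m. D k 0 / fact k * h ^ k) + D m \<xi> / fact m * h ^ m"
      using Maclaurin2[of h D "D 0" m] h deriv by auto
    have "(\<Sum>k<m. D k 0 / fact k * h ^ k) = 0" by (rule sum.neutral) (use zero in auto)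
    then have "D 0 h / h ^ m = D m \<xi> / fact m" using \<xi>(3) h by simp
    then show ?thesis using \<xi> by blast
  qed
  then obtain \<xi> where \<xi>: "\<And>h. h \<in> {0<..<\<rho>} \<Longrightarrow> 0 < \<xi> h \<and> \<xi> h \<le> h \<and> D 0 h / h ^ m = D m (\<xi> h) / fact m"
    by metis
  have ev: "\<forall>\<^sub>F h in at_right 0. h \<in> {0<..<\<rho>}" using \<rho> by (rule eventually_at_right_real)
  have "(\<xi> \<longlongrightarrow> 0) (at_right 0)"
  proof (rule tendsto_sandwich[of "\<lambda>_. 0" _ _ "\<lambda>h. h"])
    show "\<forall>\<^sub>F h in at_right 0. 0 \<le> \<xi> h" "\<forall>\<^sub>F h in at_right 0. \<xi> h \<le> h"
      using \<xi> by (auto intro!: eventually_mono[OF ev] intro: less_imp_le)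
  qed (auto intro: tendsto_intros)
  moreover have "isCont (D m) 0" using deriv[of 0 m] \<rho> by (auto intro: DERIV_isCont)
  ultimately have "((\<lambda>h. D m (\<xi> h)) \<longlongrightarrow> D m 0) (at_right 0)"
    by (rule isCont_tendsto_compose[rotated])
  then have "((\<lambda>h. D m (\<xi> h) / fact m) \<longlongrightarrow> D m 0 / fact m) (at_right 0)"
    by (intro tendsto_intros) auto
  then show ?thesis
    by (rule Lim_transform_eventually) (use \<xi> in \<open>auto intro!: eventually_mono[OF ev]\<close>)
qed

text \<open>
  This describes the vanishing of derivatives by the size of the function alone, which is
  what makes different lifts comparable.
\<close>

lemma jet_vanishes_iff_small:
  fixes D :: "nat \<Rightarrow> real \<Rightarrow> real"
  assumes \<rho>: "0 < \<rho>"
    and deriv: "\<And>k s. 0 \<le> s \<Longrightarrow> s < \<rho> \<Longrightarrow> (D k has_real_derivative D (Suc k) s) (at s)"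
  shows "(\<forall>k\<le>m. D k 0 = 0) \<longleftrightarrow> ((\<lambda>s. D 0 s / s ^ m) \<longlongrightarrow> 0) (at_right 0)"
proof
  assume *: "\<forall>k\<le>m. D k 0 = 0"
  then show "((\<lambda>s. D 0 s / s ^ m) \<longlongrightarrow> 0) (at_right 0)"
    using taylor_quotient_limit[where D = D and m = m, OF \<rho>] deriv by simp
next
  assume small: "((\<lambda>s. D 0 s / s ^ m) \<longlongrightarrow> 0) (at_right 0)"
  have "k \<le> m \<longrightarrow> D k 0 = 0" for k
  proof (induction k rule: less_induct)
    case (less k)
    show ?case
    proof
      assume k: "k \<le> m"
      have "((\<lambda>s. D 0 s / s ^ k) \<longlongrightarrow> D k 0 / fact k) (at_right 0)"
      proof (rule taylor_quotient_limit[where D = D and m = k, OF \<rho> deriv])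
        show "D j 0 = 0" if "j < k" for j using less[OF that] that k by simp
      qed
      moreover have "((\<lambda>s. D 0 s / s ^ k) \<longlongrightarrow> 0) (at_right 0)"
      proof (rule Lim_transform_eventually)
        have "((\<lambda>s. D 0 s / s ^ m * s ^ (m - k)) \<longlongrightarrow> 0 * 0 ^ (m - k)) (at_right 0)"
          by (intro tendsto_intros small)
        then show "((\<lambda>s. D 0 s / s ^ m * s ^ (m - k)) \<longlongrightarrow> 0) (at_right 0)" by simp
        show "\<forall>\<^sub>F s in at_right 0. D 0 s / s ^ m * s ^ (m - k) = D 0 s / s ^ k"
          by (rule eventually_mono[OF eventually_at_right_less]) (use k in \<open>simp add: power_diff\<close>)
      qed
      ultimately have "D k 0 / fact k = 0" using tendsto_unique[OF trivial_limit_at_right_real] by blast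
      then show "D k 0 = 0" by simp
    qed
  qed
  then show "\<forall>k\<le>m. D k 0 = 0" by blast
qed

lemma local_lift_interior:
  assumes "local_lift I c t J g" "t \<in> interior I"
  shows "t \<in> interior J"
proof -
  obtain S where S: "open S" "J = I \<inter> S" using assms(1) by (auto simp: local_lift_def openin_open)
  moreover have "t \<in> J" using assms(1) by (simp add: local_lift_def)
  ultimately show ?thesis using assms(2) by (simp add: interior_open)
qed

lemma lift_component_derivative:
  fixes g :: "real \<Rightarrow> real ^ 'n" and l :: "real ^ 'n \<Rightarrow> real"
  assumes "smooth_map_on J g" "linear l" "t + s \<in> interior J"
  shows "((\<lambda>s. l (iter_deriv J k g (t + s))) has_real_derivative l (iter_deriv J (Suc k) g (t + s))) (at s)"
proof -
  have "((\<lambda>s. t + s) has_vector_derivative 1) (at s)"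
    by (auto intro!: derivative_eq_intros)
  then have "((iter_deriv J k g \<circ> (\<lambda>s. t + s)) has_vector_derivative 1 *\<^sub>R iter_deriv J (Suc k) g (t + s)) (at s)"
    by (rule vector_diff_chain_at) (rule smooth_map_on_has_vector_derivative[OF assms(1,3)])
  then have "((\<lambda>s. l ((iter_deriv J k g \<circ> (\<lambda>s. t + s)) s)) has_vector_derivative
      l (1 *\<^sub>R iter_deriv J (Suc k) g (t + s))) (at s)"
    by (rule bounded_linear.has_vector_derivative[OF linear_conv_bounded_linear[THEN iffD1, OF assms(2)]])
  then show ?thesis by (simp add: has_real_derivative_iff_has_vector_derivative o_def)
qed

text \<open>
  Two lifts differ near \<open>t\<close> by a scalar factor whose absolute value is the quotient of the norms of
  the lifts and hence is bounded near \<open>t\<close>. By \<open>jet_vanishes_iff_small\<close>, such a factor preserves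
  the vanishing of derivatives.
\<close>

lemma local_lifts_same_annihilators:
  fixes c :: "real \<Rightarrow> (real ^ 'n) set" and l :: "real ^ 'n \<Rightarrow> real"
  assumes lift: "local_lift I c t J g" "local_lift I c t J' g'" and t: "t \<in> interior I"
    and l: "linear l" and zero: "\<And>k. k < i \<Longrightarrow> l (iter_deriv J k g t) = 0" and k: "k < i"
  shows "l (iter_deriv J' k g' t) = 0"
proof -
  have sm: "smooth_map_on J g" "smooth_map_on J' g'" using lift by (auto simp: local_lift_def)
  have "t \<in> interior J \<inter> interior J'" using lift t local_lift_interior by blast
  then obtain \<rho> where \<rho>: "0 < \<rho>" "ball t \<rho> \<subseteq> interior J \<inter> interior J'"
    using openE[of "interior J \<inter> interior J'" t] by blast
  have inJ: "t + s \<in> interior J" "t + s \<in> interior J'" if "0 \<le> s" "s < \<rho>" for s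
    using \<rho>(2) that by (auto simp: subset_iff dist_real_def)
  obtain m where m: "i = Suc m" using k by (cases i) auto
  have lim: "((\<lambda>s. l (g (t + s)) / s ^ m) \<longlongrightarrow> 0) (at_right 0)"
    using jet_vanishes_iff_small[where D = "\<lambda>k s. l (iter_deriv J k g (t + s))" and m = m, OF \<rho>(1)]
      lift_component_derivative[OF sm(1) l inJ(1)] zero m
    by (simp add: iter_deriv_0 less_Suc_eq_le)
  have cont: "((\<lambda>s. h (t + s)) \<longlongrightarrow> h t) (at_right 0)" if "(h has_vector_derivative h') (at t)" for h :: "real \<Rightarrow> real ^ 'n" and h'
  proof -
    have "isCont h t" using that by (rule has_vector_derivative_continuous)
    then show ?thesis
      by (rule isCont_tendsto_compose) (auto intro!: tendsto_eq_intros)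
  qed
  have g: "((\<lambda>s. g (t + s)) \<longlongrightarrow> g t) (at_right 0)" "((\<lambda>s. g' (t + s)) \<longlongrightarrow> g' t) (at_right 0)"
    using cont[OF smooth_map_on_has_vector_derivative[OF sm(1), of t 0]]
      cont[OF smooth_map_on_has_vector_derivative[OF sm(2), of t 0]] inJ[of 0] \<rho>(1)
    by (simp_all add: iter_deriv_0)
  have gt: "g t \<noteq> 0" using lift(1) by (simp add: local_lift_def)
  have "((\<lambda>s. norm (g' (t + s)) / norm (g (t + s)) * \<bar>l (g (t + s)) / s ^ m\<bar>) \<longlongrightarrow>
     norm (g' t) / norm (g t) * \<bar>0\<bar>) (at_right 0)"
    using gt by (intro tendsto_intros g lim) auto
  then have "((\<lambda>s. norm (g' (t + s)) / norm (g (t + s)) * \<bar>l (g (t + s)) / s ^ m\<bar>) \<longlongrightarrow> 0) (at_right 0)" by simp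
  then have "((\<lambda>s. \<bar>l (g' (t + s)) / s ^ m\<bar>) \<longlongrightarrow> 0) (at_right 0)"
  proof (rule Lim_transform_eventually)
    show "\<forall>\<^sub>F s in at_right 0. norm (g' (t + s)) / norm (g (t + s)) * \<bar>l (g (t + s)) / s ^ m\<bar> = \<bar>l (g' (t + s)) / s ^ m\<bar>"
    proof (rule eventually_mono[OF eventually_at_right_real[OF \<rho>(1)]])
      fix s assume s: "s \<in> {0<..<\<rho>}"
      have "t + s \<in> J" "t + s \<in> J'" using inJ[of s] s interior_subset by auto
      then have gs: "g (t + s) \<noteq> 0" "span {g (t + s)} = span {g' (t + s)}"
        using lift by (auto simp: local_lift_def)
      then have "g' (t + s) \<in> span {g (t + s)}" using span_base[of "g' (t + s)" "{g' (t + s)}"] by simp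
      \<comment> \<open>both lifts span the same line at \<open>t + s\<close>\<close>
      then obtain \<phi> where \<phi>: "g' (t + s) = \<phi> *\<^sub>R g (t + s)" by (auto simp: span_singleton)
      then show "norm (g' (t + s)) / norm (g (t + s)) * \<bar>l (g (t + s)) / s ^ m\<bar> = \<bar>l (g' (t + s)) / s ^ m\<bar>"
        using gs(1) by (simp add: linear_scale[OF l] abs_mult)
    qed
  qed
  then have "((\<lambda>s. l (g' (t + s)) / s ^ m) \<longlongrightarrow> 0) (at_right 0)" by (rule tendsto_rabs_zero_cancel)
  then have "\<forall>k\<le>m. l (iter_deriv J' k g' t) = 0"
    using jet_vanishes_iff_small[where D = "\<lambda>k s. l (iter_deriv J' k g' (t + s))" and m = m, OF \<rho>(1)]
      lift_component_derivative[OF sm(2) l inJ(2)]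
    by (simp add: iter_deriv_0)
  then show ?thesis using k m by simp
qed

lemma span_subset_of_annihilators:
  fixes A B :: "'a::euclidean_space set"
  assumes "\<And>a. (\<And>x. x \<in> A \<Longrightarrow> inner a x = 0) \<Longrightarrow> (\<And>x. x \<in> B \<Longrightarrow> inner a x = 0)"
  shows "span B \<subseteq> span A"
proof -
  have "B \<subseteq> orthogonal_comp (orthogonal_comp (span A))"
  proof
    fix b assume b: "b \<in> B"
    have "inner a b = 0" if "a \<in> orthogonal_comp (span A)" for a
    proof (rule assms[OF _ b])
      fix x assume "x \<in> A"
      then show "inner a x = 0"
        using that span_base[of x A] inner_commute[of a x]
        by (simp add: orthogonal_comp_def real_inner_class.orthogonal_def)
    qed
    then show "b \<in> orthogonal_comp (orthogonal_comp (span A))"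
      unfolding orthogonal_comp_def[of "orthogonal_comp (span A)"]
      by (simp add: real_inner_class.orthogonal_def)
  qed
  then have "B \<subseteq> span A" by (simp add: orthogonal_comp_self)
  then show ?thesis by (simp add: span_minimal)
qed

text \<open>
  A subspace is determined by the linear forms vanishing on it, so this reduces to
  \<open>local_lifts_same_annihilators\<close>.
\<close>

lemma osculating_flag_eq_span:
  fixes c :: "real \<Rightarrow> (real ^ 'n) set"
  assumes lift: "local_lift I c t J g" and t: "t \<in> interior I"
  shows "osculating_flag I c t i = span ((\<lambda>k. iter_deriv J k g t) ` {..<i})"
proof -
  let ?P = "\<lambda>V. \<exists>J g. local_lift I c t J g \<and> V = span ((\<lambda>k. iter_deriv J k g t) ` {..<i})"
  have "?P (osculating_flag I c t i)"
    unfolding osculating_flag_def by (rule someI_ex) (use lift in blast)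
  then obtain J' g' where 1: "local_lift I c t J' g'"
    "osculating_flag I c t i = span ((\<lambda>k. iter_deriv J' k g' t) ` {..<i})" by blast
  have "span ((\<lambda>k. iter_deriv J2 k g2 t) ` {..<i}) \<subseteq> span ((\<lambda>k. iter_deriv J1 k g1 t) ` {..<i})"
    if "local_lift I c t J1 g1" "local_lift I c t J2 g2" for J1 g1 J2 g2
  proof (rule span_subset_of_annihilators)
    fix a x assume "\<And>x. x \<in> (\<lambda>k. iter_deriv J1 k g1 t) ` {..<i} \<Longrightarrow> inner a x = 0"
      "x \<in> (\<lambda>k. iter_deriv J2 k g2 t) ` {..<i}"
    then show "inner a x = 0"
      using local_lifts_same_annihilators[OF that t, of "\<lambda>x. inner a x" i]
      by (auto intro: bounded_linear.linear bounded_linear_inner_right)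
  qed
  then show ?thesis using 1 lift by blast
qed

lemma enat_term_le_infsum:
  fixes f :: "'a \<Rightarrow> enat"
  assumes "t \<in> T"
  shows "f t \<le> (\<Sum>\<^sub>\<infinity>s\<in>T. f s)"
proof -
  have "infsum f {t} \<le> infsum f T"
    by (rule infsum_mono_neutral) (use assms in \<open>auto intro!: nonneg_summable_on_complete\<close>)
  then show ?thesis by simp
qed

text \<open>
  If the derivatives did not span, a form \<open>l\<close> vanishing on all of them would have local
  multiplicity at least \<open>n\<close> at \<open>t\<close>, and already this single summand would violate convexity.
\<close>

lemma convex_curve_jets_span:
  fixes c :: "real \<Rightarrow> (real ^ 'n) set"
  assumes convex: "globally_convex I T c" and t: "t \<in> T" "t \<in> interior I"
    and lift: "local_lift I c t J g"
  shows "span ((\<lambda>k. iter_deriv J k g t) ` {..<CARD('n)}) = UNIV"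
proof (rule ccontr)
  assume "span ((\<lambda>k. iter_deriv J k g t) ` {..<CARD('n)}) \<noteq> UNIV"
  then obtain a where a: "a \<noteq> 0" "\<forall>x\<in>span ((\<lambda>k. iter_deriv J k g t) ` {..<CARD('n)}). inner a x = 0"
    using span_not_UNIV_orthogonal by blast
  define l where "l = (\<lambda>x. inner a x)"
  have l: "linear l" unfolding l_def by (intro bounded_linear.linear bounded_linear_inner_right)
  have "\<exists>m J g. local_lift I c t J g \<and> m = vanishing_order J (l \<circ> g) t" using lift by blast
  then have "\<exists>J g. local_lift I c t J g \<and> local_mult I c l t = vanishing_order J (l \<circ> g) t"
    unfolding local_mult_def by (rule someI_ex)
  then obtain J' g' where 1: "local_lift I c t J' g'" "local_mult I c l t = vanishing_order J' (l \<circ> g') t"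
    by blast
  have "iter_deriv J' k (l \<circ> g') t = 0" if "k < CARD('n)" for k
  proof -
    have "l (iter_deriv J' k g' t) = 0"
    proof (rule local_lifts_same_annihilators[OF lift 1(1) t(2) l _ that])
      fix k assume "k < CARD('n)"
      then have "iter_deriv J k g t \<in> span ((\<lambda>k. iter_deriv J k g t) ` {..<CARD('n)})"
        by (intro span_base imageI) simp
      then show "l (iter_deriv J k g t) = 0" using a(2) by (simp add: l_def)
    qed
    then show ?thesis
      using iter_deriv_linear_comp[OF _ l local_lift_interior[OF 1(1) t(2)], of g' k] 1(1)
      by (simp add: local_lift_def)
  qed
  then have "enat CARD('n) \<le> local_mult I c l t"
    unfolding 1(2) vanishing_order_def by (intro INF_greatest) (auto simp: not_less[symmetric])
  also have "\<dots> \<le> (\<Sum>\<^sub>\<infinity>t\<in>T. local_mult I c l t)" by (rule enat_term_le_infsum[OF t(1)])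
  also have "\<dots> \<le> enat (CARD('n) - 1)"
  proof -
    have "l a \<noteq> 0" using a by (simp add: l_def)
    then show ?thesis using convex l unfolding globally_convex_def by blast
  qed
  finally have "CARD('n) \<le> CARD('n) - 1" by (simp only: enat_ord_simps)
  moreover have "0 < CARD('n)" by simp
  ultimately show False by linarith
qed

section \<open>A flag with many non-transversal parameters\<close>

lemma falling_eq_fact: "k \<le> j \<Longrightarrow> falling j k = fact j / fact (j - k)"
proof (induction k)
  case 0
  then show ?case by (simp add: falling_def)
next
  case (Suc k)
  have "falling j (Suc k) = falling j k * (real j - real k)" by (simp add: falling_def)
  also have "\<dots> = fact j / fact (j - k) * (real j - real k)" using Suc by simp
  also have "(fact (j - k) :: real) = (real j - real k) * fact (j - Suc k)"
  proof -
    have "j - k = Suc (j - Suc k)" using Suc.prems by simp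
    then show ?thesis using Suc.prems fact_Suc[of "j - Suc k"] by (simp add: of_nat_diff)
  qed
  finally show ?case using Suc.prems by simp
qed

lemma falling_eq_0: "j < k \<Longrightarrow> falling j k = 0"
  unfolding falling_def by (rule prod_zero) auto

text \<open>
  A function with the same derivatives at \<open>0\<close> as \<open>t ^ j\<close> up to order \<open>j\<close> has, to leading order, the
  derivatives of \<open>t ^ j\<close>. For \<open>k > j\<close> this only says that \<open>t ^ (k - j)\<close> tends to \<open>0\<close>.
\<close>

lemma normalized_jet_limit:
  fixes D :: "nat \<Rightarrow> real \<Rightarrow> real"
  assumes \<rho>: "0 < \<rho>"
    and deriv: "\<And>k s. 0 \<le> s \<Longrightarrow> s < \<rho> \<Longrightarrow> (D k has_real_derivative D (Suc k) s) (at s)"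
    and jet: "\<And>k. k \<le> j \<Longrightarrow> D k 0 = (if k = j then fact j else 0)"
  shows "((\<lambda>t. t ^ k * D k t / t ^ j) \<longlongrightarrow> falling j k) (at_right 0)"
proof (cases "k \<le> j")
  case True
  have "((\<lambda>t. D (k + 0) t / t ^ (j - k)) \<longlongrightarrow> D (k + (j - k)) 0 / fact (j - k)) (at_right 0)"
  proof (rule taylor_quotient_limit[where D = "\<lambda>m. D (k + m)" and m = "j - k", OF \<rho>])
    show "(D (k + m) has_real_derivative D (k + Suc m) s) (at s)" if "0 \<le> s" "s < \<rho>" for m s
      using deriv[OF that, of "k + m"] by simp
    show "D (k + m) 0 = 0" if "m < j - k" for m using jet[of "k + m"] that by simp
  qed
  then have "((\<lambda>t. D k t / t ^ (j - k)) \<longlongrightarrow> falling j k) (at_right 0)"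
    using True jet[of j] falling_eq_fact by simp
  then show ?thesis
    by (rule Lim_transform_eventually)
      (rule eventually_mono[OF eventually_at_right_less], use True in \<open>simp add: power_diff field_simps\<close>)
next
  case False
  have "isCont (D k) 0" using deriv[of 0 k] \<rho> by (auto intro: DERIV_isCont)
  then have "(D k \<longlongrightarrow> D k 0) (at_right 0)" by (simp add: isCont_def filterlim_at_split)
  then have "((\<lambda>t. t ^ (k - j) * D k t) \<longlongrightarrow> 0 ^ (k - j) * D k 0) (at_right 0)"
    by (intro tendsto_intros)
  moreover have "0 ^ (k - j) * D k 0 = falling j k" using False falling_eq_0 by (simp add: zero_power)
  ultimately have "((\<lambda>t. t ^ (k - j) * D k t) \<longlongrightarrow> falling j k) (at_right 0)" by simp
  then show ?thesis
    by (rule Lim_transform_eventually)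
      (rule eventually_mono[OF eventually_at_right_less], use False in \<open>simp add: power_diff field_simps\<close>)
qed

text \<open>
  As many vectors as the dimension which span the space form a basis, so a linear form can be
  prescribed on them; for \<open>j\<close> below the
  dimension, this one is \<open>w\<close> times a member of the dual basis.
\<close>

lemma spanning_family_dual:
  fixes X :: "nat \<Rightarrow> 'a::euclidean_space"
  assumes "span (X ` {..<DIM('a)}) = UNIV"
  shows "\<exists>l :: 'a \<Rightarrow> real. linear l \<and> (\<forall>k<DIM('a). l (X k) = (if k = j then w else 0))"
proof -
  let ?S = "X ` {..<DIM('a)}"
  have "DIM('a) \<le> card ?S"
    using dim_le_card'[of ?S] assms dim_span[of ?S] by simp
  moreover have "card ?S \<le> DIM('a)" using card_image_le[of "{..<DIM('a)}" X] by simp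
  ultimately have card: "card ?S = DIM('a)" by simp
  then have inj: "inj_on X {..<DIM('a)}" by (intro eq_card_imp_inj_on) auto
  have "independent ?S"
    by (rule card_le_dim_spanning[of _ UNIV]) (use assms card in auto)
  from linear_independent_extend[OF this, of "\<lambda>x. if j < DIM('a) \<and> x = X j then w else 0"]
  obtain l :: "'a \<Rightarrow> real" where l: "linear l" "\<forall>x\<in>?S. l x = (if j < DIM('a) \<and> x = X j then w else 0)"
    by (elim exE conjE) (rule that)
  have "l (X k) = (if k = j then w else 0)" if "k < DIM('a)" for k
    using l(2) that inj by (auto simp: inj_on_def)
  then show ?thesis using l(1) by blast
qed

lemma spanning_family_coefficients_0:
  fixes X :: "nat \<Rightarrow> 'a::euclidean_space"
  assumes span: "span (X ` {..<DIM('a)}) = UNIV" and "i \<le> DIM('a)"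
    and zero: "(\<Sum>k<i. a k *\<^sub>R X k) = 0" and j: "j < i"
  shows "a j = 0"
proof -
  obtain l :: "'a \<Rightarrow> real" where l: "linear l"
    "\<And>k. k < DIM('a) \<Longrightarrow> l (X k) = (if k = j then 1 else 0)"
    using spanning_family_dual[OF span, of j 1] by auto
  have "0 = l (\<Sum>k<i. a k *\<^sub>R X k)" using zero linear_0[OF l(1)] by simp
  also have "\<dots> = (\<Sum>k<i. a k * l (X k))"
    by (simp add: linear_sum[OF l(1)] linear_scale[OF l(1)])
  also have "\<dots> = (\<Sum>k<i. if k = j then a k else 0)"
    by (rule sum.cong) (use l(2) assms(2) in auto)
  also have "\<dots> = a j" using j by simp
  finally show ?thesis by simp
qed

text \<open>
  The forms \<open>l j / w j\<close> are the coordinates with respect to the vectors \<open>X j\<close>.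
\<close>

lemma dual_family_separates:
  fixes X :: "nat \<Rightarrow> 'a::euclidean_space" and l :: "nat \<Rightarrow> 'a \<Rightarrow> real"
  assumes span: "span (X ` {..<n}) = UNIV"
    and l: "\<And>j. j < n \<Longrightarrow> linear (l j)"
      "\<And>j k. j < n \<Longrightarrow> k < n \<Longrightarrow> l j (X k) = (if k = j then w j else 0)"
    and w: "\<And>j. j < n \<Longrightarrow> w j \<noteq> 0"
    and v: "\<And>j. j < n \<Longrightarrow> l j v = 0"
  shows "v = 0"
proof -
  have "id v = (\<lambda>v. \<Sum>j<n. (l j v / w j) *\<^sub>R X j) v"
  proof (rule linear_eq_on_span[of id _ "X ` {..<n}"])
    show "linear (\<lambda>v. \<Sum>j<n. (l j v / w j) *\<^sub>R X j)"
    proof (rule linear_compose_sum, rule ballI)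
      fix j assume "j \<in> {..<n}"
      then have "linear (l j)" using l by simp
      then show "linear (\<lambda>v. (l j v / w j) *\<^sub>R X j)"
        by (intro linearI) (simp_all add: linear_add linear_scale scaleR_add_left add_divide_distrib)
    qed
    show "id x = (\<Sum>j<n. (l j x / w j) *\<^sub>R X j)" if "x \<in> X ` {..<n}" for x
    proof -
      obtain k where k: "k < n" "x = X k" using \<open>x \<in> X ` {..<n}\<close> by auto
      have "(\<Sum>j<n. (l j x / w j) *\<^sub>R X j) = (\<Sum>j<n. if j = k then X j else 0)"
        by (rule sum.cong) (use l(2) k w in auto)
      then show ?thesis using k by simp
    qed
  qed (use span linear_id in auto)
  then show ?thesis using v by simp
qed

definition flag_form :: "nat \<Rightarrow> (nat \<Rightarrow> 'a \<Rightarrow> real) \<Rightarrow> real \<Rightarrow> nat \<Rightarrow> 'a \<Rightarrow> real" where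
  "flag_form n l e r v = (\<Sum>j<n. form_coeff n e r j * l j v)"

definition common_kernel :: "nat \<Rightarrow> (nat \<Rightarrow> 'a \<Rightarrow> real) \<Rightarrow> real \<Rightarrow> nat \<Rightarrow> 'a set" where
  "common_kernel n l e i = {v. \<forall>r<i. flag_form n l e r v = 0}"

lemma linear_flag_form:
  assumes "\<And>j. j < n \<Longrightarrow> linear (l j)"
  shows "linear (flag_form n l e r)"
proof -
  have "linear (\<lambda>v. \<Sum>j<n. form_coeff n e r j * l j v)"
    by (rule linear_compose_sum, rule ballI, rule linearI)
      (use assms in \<open>auto simp: linear_add linear_scale algebra_simps\<close>)
  then show ?thesis unfolding flag_form_def[abs_def] .
qed

text \<open>
  The values of the forms at \<open>v\<close> are the values at the powers \<open>e ^ ((r + 1) * gap n)\<close>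
  of a single polynomial whose coefficients are multiples of \<open>l j v\<close>. Its degree is less than \<open>n\<close>, so
  \<open>n\<close> distinct roots force all coefficients to vanish.
\<close>

lemma flag_forms_separate:
  assumes e: "0 < e" "e < 1"
    and zero: "\<And>r. r < n \<Longrightarrow> flag_form n l e r v = 0" and j: "j < n"
  shows "l j v = 0"
proof -
  define Q where "Q = (\<Sum>j<n. Polynomial.monom ((- 1) ^ j * e ^ (j * (j - 1)) * l j v) (n - 1 - j))"
  have Q: "poly Q (e ^ ((r + 1) * gap n)) = flag_form n l e r v" for r
    unfolding Q_def flag_form_def poly_sum
  proof (rule sum.cong[OF refl])
    fix j
    have "(e ^ ((r + 1) * gap n)) ^ (n - 1 - j) = e ^ ((r + 1) * gap n * (n - 1 - j))"
      by (simp only: power_mult)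
    then show "poly (Polynomial.monom ((- 1) ^ j * e ^ (j * (j - 1)) * l j v) (n - 1 - j)) (e ^ ((r + 1) * gap n))
        = form_coeff n e r j * l j v"
      unfolding poly_monom form_coeff_def weight_def power_add by (simp only: mult_ac)
  qed
  have "Q = 0"
  proof (rule poly_eq_0_of_many_roots[of "(\<lambda>r. e ^ ((r + 1) * gap n)) ` {..<n}"])
    have "inj_on (\<lambda>r. e ^ ((r + 1) * gap n)) {..<n}"
    proof (rule inj_onI)
      fix a b assume eq: "e ^ ((a + 1) * gap n) = e ^ ((b + 1) * gap n)"
      have "(a + 1) * gap n = (b + 1) * gap n"
        using eq power_strict_decreasing[of "(a + 1) * gap n" "(b + 1) * gap n" e]
          power_strict_decreasing[of "(b + 1) * gap n" "(a + 1) * gap n" e] e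
        by (cases "(a + 1) * gap n" "(b + 1) * gap n" rule: linorder_cases) simp_all
      then show "a = b" unfolding gap_def by (simp only: mult_cancel2) simp
    qed
    moreover have "degree Q \<le> n - 1" unfolding Q_def
      by (rule degree_sum_le) (auto intro: order.trans[OF degree_monom_le])
    ultimately show "degree Q < card ((\<lambda>r. e ^ ((r + 1) * gap n)) ` {..<n})"
      using j by (simp add: card_image)
    show "poly Q x = 0" if "x \<in> (\<lambda>r. e ^ ((r + 1) * gap n)) ` {..<n}" for x
      using that zero Q by auto
  qed simp
  then have "0 = coeff Q (n - 1 - j)" by simp
  also have "\<dots> = (\<Sum>i<n. if i = j then (- 1) ^ i * e ^ (i * (i - 1)) * l i v else 0)"
    unfolding Q_def coeff_sum by (rule sum.cong) (use j in auto)
  also have "\<dots> = (- 1) ^ j * e ^ (j * (j - 1)) * l j v" using j by simp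
  finally show ?thesis using e by simp
qed

lemma dim_kernel_step:
  fixes f :: "'a::euclidean_space \<Rightarrow> real"
  assumes f: "linear f" and S: "subspace S"
  shows "dim S \<le> dim (S \<inter> {x. f x = 0}) + 1"
proof (cases "S \<subseteq> {x. f x = 0}")
  case True
  then show ?thesis by (simp add: Int_absorb2)
next
  case False
  then obtain s where s: "s \<in> S" "f s \<noteq> 0" by blast
  have "S \<subseteq> span (insert s (S \<inter> {x. f x = 0}))"
  proof
    fix x assume x: "x \<in> S"
    \<comment> \<open>the projection of \<open>x\<close> to the kernel along \<open>s\<close>\<close>
    define y where "y = x - (f x / f s) *\<^sub>R s"
    have "f y = 0" using s f by (simp add: y_def linear_diff linear_scale)
    moreover have "y \<in> S" unfolding y_def using S s x by (intro subspace_diff subspace_scale)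
    ultimately have "y \<in> S \<inter> {x. f x = 0}" by simp
    then have "y + (f x / f s) *\<^sub>R s \<in> span (insert s (S \<inter> {x. f x = 0}))"
      by (intro span_add span_scale span_base) auto
    then show "x \<in> span (insert s (S \<inter> {x. f x = 0}))" by (simp add: y_def)
  qed
  then have "dim S \<le> dim (insert s (S \<inter> {x. f x = 0}))"
    by (metis dim_span dim_subset)
  also have "\<dots> \<le> dim (S \<inter> {x. f x = 0}) + 1" by (simp add: dim_insert)
  finally show ?thesis .
qed

text \<open>
  Each further form lowers the dimension by at most one. As \<open>n\<close> forms lower it from \<open>n\<close> to \<open>0\<close>,
  each of them lowers it by exactly one.
\<close>

lemma complete_flag_common_kernel:
  fixes l :: "nat \<Rightarrow> real ^ 'n \<Rightarrow> real"
  assumes n: "n = CARD('n)" and l: "\<And>j. j < n \<Longrightarrow> linear (l j)"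
    and sep: "\<And>v. (\<And>j. j < n \<Longrightarrow> l j v = 0) \<Longrightarrow> v = 0" and e: "0 < e" "e < 1"
  shows "complete_flag (\<lambda>m. common_kernel n l e (n - m))"
proof -
  let ?H = "common_kernel n l e"
  have sub: "subspace (?H i)" for i
    using linear_flag_form[OF l] unfolding common_kernel_def
    by (auto simp: subspace_def linear_0 linear_add linear_scale)
  have H_Suc: "?H (Suc i) = ?H i \<inter> {v. flag_form n l e i v = 0}" for i
    by (auto simp: common_kernel_def less_Suc_eq)
  have step: "dim (?H i) \<le> dim (?H (Suc i)) + 1" for i
    unfolding H_Suc by (rule dim_kernel_step[OF linear_flag_form[OF l] sub])
  have "?H 0 = UNIV" by (simp add: common_kernel_def)
  then have H0: "dim (?H 0) = n" by (simp add: n)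
  have "?H n = {0}"
  proof
    show "{0} \<subseteq> ?H n" using subspace_0[OF sub] by simp
    show "?H n \<subseteq> {0}"
    proof
      fix v assume v: "v \<in> ?H n"
      have "l j v = 0" if "j < n" for j
        by (rule flag_forms_separate[where l = l and v = v, OF e _ that])
          (use v in \<open>simp add: common_kernel_def\<close>)
      then have "v = 0" by (rule sep)
      then show "v \<in> {0}" by simp
    qed
  qed
  then have Hn: "dim (?H n) = 0" by simp
  have lower: "n \<le> dim (?H i) + i" for i
  proof (induction i)
    case (Suc i)
    then show ?case using step[of i] by linarith
  qed (simp add: H0)
  have "dim (?H (n - k)) \<le> k" if "k \<le> n" for k
    using that
  proof (induction k)
    case (Suc k)
    then have "n - k = Suc (n - Suc k)" by simp
    then have "dim (?H (n - Suc k)) \<le> dim (?H (n - k)) + 1" using step[of "n - Suc k"] by simp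
    then show ?case using Suc by simp
  qed (simp add: Hn)
  then have dim: "dim (?H (n - m)) = m" if "m \<le> n" for m
    using lower[of "n - m"] that by (simp add: le_antisym)
  show ?thesis
    unfolding complete_flag_def n[symmetric]
    using sub dim by (auto simp: common_kernel_def)
qed

text \<open>
  If the Wronskian vanishes, its matrix has a nonzero kernel vector, the coefficients of a combination of the
  first \<open>i\<close> derivatives on which the first \<open>i\<close> forms vanish; the combination is nonzero because the
  derivatives are independent.
\<close>

lemma not_transversal_of_flag_wronskian_0:
  fixes X :: "nat \<Rightarrow> real ^ 'n" and l :: "nat \<Rightarrow> real ^ 'n \<Rightarrow> real"
  assumes n: "n = CARD('n)" and l: "\<And>j. j < n \<Longrightarrow> linear (l j)"
    and span: "span (X ` {..<n}) = UNIV" and i: "1 \<le> i" "i < n"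
    and F: "\<And>i. F i = span (X ` {..<i})"
    and zero: "flag_wronskian n (\<lambda>j k t. l j (X k)) e i t = 0"
  shows "\<not> transversal_flags F (\<lambda>m. common_kernel n l e (n - m))"
proof -
  obtain a where a: "\<exists>k<i. a k \<noteq> 0"
    "\<forall>r<i. (\<Sum>k<i. (\<Sum>j<n. form_coeff n e r j * l j (X k)) * a k) = 0"
    using null_vector_of_det_0[OF zero[unfolded flag_wronskian_def]] by blast
  define v where "v = (\<Sum>k<i. a k *\<^sub>R X k)"
  have "v \<noteq> 0"
    using a(1) spanning_family_coefficients_0[of X i a] span i by (auto simp: v_def n)
  moreover have "v \<in> F i"
    unfolding F v_def by (intro span_sum span_scale span_base) auto
  moreover have "flag_form n l e r v = 0" if "r < i" for r
  proof -
    have lin: "linear (flag_form n l e r)" by (rule linear_flag_form[OF l])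
    have "flag_form n l e r v = (\<Sum>k<i. a k * flag_form n l e r (X k))"
      unfolding v_def by (simp add: linear_sum[OF lin] linear_scale[OF lin])
    also have "\<dots> = 0" using a(2) that by (simp add: flag_form_def mult.commute)
    finally show ?thesis .
  qed
  then have "v \<in> common_kernel n l e (n - (n - i))" using i by (simp add: common_kernel_def)
  ultimately have "F i \<inter> common_kernel n l e (n - (n - i)) \<noteq> {0}" by blast
  moreover have "i \<in> {1..n - 1}" using i by simp
  ultimately show ?thesis
    unfolding transversal_flags_def n[symmetric] by blast
qed

text \<open>
  The half-open interval leaves room for \<open>t0 = 0\<close> on the circle, whose parameters start at \<open>0\<close>: all
  zeros found lie to the right of \<open>t0\<close>.
\<close>

lemma sharp_lower_bound:
  fixes c :: "real \<Rightarrow> (real ^ 'n) set"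
  assumes convex: "globally_convex I T c"
    and t0: "{t0..<t0 + \<rho>} \<subseteq> T \<inter> interior I" "0 < \<rho>"
  shows "\<exists>m. 6 * m + CARD('n) = CARD('n) ^ 3 \<and> enat m \<le> sharp I T c"
proof -
  define n where "n = CARD('n)"
  have t0I: "t0 \<in> T" "t0 \<in> interior I" using t0 by auto
  obtain J g where lift: "local_lift I c t0 J g"
    using convex t0I(2) interior_subset unfolding globally_convex_def smooth_curve_def by blast
  have sm: "smooth_map_on J g" using lift by (simp add: local_lift_def)
  have "t0 \<in> interior J" using local_lift_interior[OF lift t0I(2)] .
  then obtain \<sigma> where \<sigma>: "0 < \<sigma>" "ball t0 \<sigma> \<subseteq> interior J" using openE[OF open_interior] by blast
  define \<tau> where "\<tau> = min \<rho> \<sigma>"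
  have \<tau>: "0 < \<tau>" using \<sigma> t0(2) by (simp add: \<tau>_def)
  have in_J: "t0 + s \<in> interior J" if "0 \<le> s" "s < \<tau>" for s
    using \<sigma>(2) that by (auto simp: \<tau>_def subset_iff dist_real_def)
  have in_T: "t0 + s \<in> T" "t0 + s \<in> interior I" if "0 \<le> s" "s < \<tau>" for s
    using t0(1) that by (auto simp: \<tau>_def)
  have lift': "local_lift I c (t0 + s) J g" if "0 \<le> s" "s < \<tau>" for s
    using lift in_J[OF that] interior_subset unfolding local_lift_def by blast
  define X where "X k s = iter_deriv J k g (t0 + s)" for k s
  have span: "span ((\<lambda>k. X k s) ` {..<n}) = UNIV" if "0 \<le> s" "s < \<tau>" for s
    unfolding X_def n_def by (rule convex_curve_jets_span[OF convex in_T[OF that] lift'[OF that]])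
  \<comment> \<open>the derivatives of \<open>t ^ j\<close> at \<open>0\<close>, so that the \<open>j\<close>-th coordinate behaves like \<open>t ^ j\<close>\<close>
  have "\<exists>l. linear l \<and> (\<forall>k<n. l (X k 0) = (if k = j then fact j else 0 :: real))" for j
  proof -
    have "span ((\<lambda>k. X k 0) ` {..<DIM(real ^ 'n)}) = UNIV" using span[of 0] \<tau> by (simp add: n_def)
    from spanning_family_dual[OF this, of j "fact j"] show ?thesis by (simp add: n_def)
  qed
  then obtain l :: "nat \<Rightarrow> real ^ 'n \<Rightarrow> real" where l: "\<And>j. linear (l j)"
    "\<And>j k. k < n \<Longrightarrow> l j (X k 0) = (if k = j then fact j else 0)" by metis
  have sep: "v = 0" if "\<And>j. j < n \<Longrightarrow> l j v = 0" for v
    by (rule dual_family_separates[of "\<lambda>k. X k 0" n l fact]) (use span[of 0] \<tau> l that in auto)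
  define u where "u j k s = l j (X k s)" for j k s
  have deriv: "(u j k has_real_derivative u j (Suc k) s) (at s)" if "0 \<le> s" "s < \<tau>" for j k s
    unfolding u_def[abs_def] X_def by (rule lift_component_derivative[OF sm l(1) in_J[OF that]])
  have lim: "((\<lambda>t. t ^ k * u j k t / t ^ j) \<longlongrightarrow> falling j k) (at_right 0)" if "j < n" "k < n" for j k
    by (rule normalized_jet_limit[where D = "u j", OF \<tau> deriv]) (use l(2) that in \<open>auto simp: u_def\<close>)
  have cont: "continuous_on {0<..<\<tau>} (u j k)" for j k
    by (rule DERIV_continuous_on[where D = "u j (Suc k)"])
      (auto intro: DERIV_subset[OF deriv] has_field_derivative_at_within deriv)
  obtain e Z where e: "0 < e" "e < 1" and Z: "Z \<subseteq> {0<..<\<tau>}" "finite Z" "6 * card Z + n = n ^ 3"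
    and root: "\<And>t. t \<in> Z \<Longrightarrow> \<exists>i\<in>{1..<n}. flag_wronskian n u e i t = 0"
    using flag_wronskian_many_roots[OF lim cont \<tau>] by blast
  define G where "G = (\<lambda>m. common_kernel n l e (n - m))"
  have G: "complete_flag G"
    unfolding G_def by (rule complete_flag_common_kernel[OF n_def l(1) sep e])
  let ?N = "{t \<in> T. \<not> transversal_flags (osculating_flag I c t) G}"
  have "(+) t0 ` Z \<subseteq> ?N"
  proof
    fix t assume "t \<in> (+) t0 ` Z"
    then obtain s where s: "s \<in> Z" "t = t0 + s" by blast
    then have s': "0 \<le> s" "s < \<tau>" using Z(1) by auto
    obtain i where i: "1 \<le> i" "i < n" "flag_wronskian n u e i s = 0" using root[OF s(1)] by auto
    have "\<not> transversal_flags (osculating_flag I c t) G"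
      unfolding G_def
    proof (rule not_transversal_of_flag_wronskian_0[OF n_def l(1) span[OF s'] i(1,2)])
      show "osculating_flag I c t i = span ((\<lambda>k. X k s) ` {..<i})" for i
        unfolding X_def s(2) by (rule osculating_flag_eq_span[OF lift'[OF s'] in_T(2)[OF s']])
      show "flag_wronskian n (\<lambda>j k t. l j (X k s)) e i s = 0"
        using i(3) by (simp add: flag_wronskian_def u_def)
    qed
    then show "t \<in> ?N" using in_T(1)[OF s'] s(2) by simp
  qed
  then have "enat (card ((+) t0 ` Z)) \<le> ecard ?N"
    by (simp add: ecard_def card_mono)
  also have "card ((+) t0 ` Z) = card Z" by (intro card_image) simp
  also have "ecard ?N \<le> sharp I T c"
    unfolding sharp_def sharp_flag_def using G by (intro SUP_upper2[of G]) auto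
  finally show ?thesis using Z(3) unfolding n_def by blast
qed

lemma sharp_ge_cubic:
  fixes c :: "real \<Rightarrow> (real ^ 'n) set"
  assumes convex: "globally_convex I T c"
    and t0: "{t0..<t0 + \<rho>} \<subseteq> T \<inter> interior I" "0 < \<rho>"
  shows "ereal ((real CARD('n) ^ 3 - real CARD('n)) / 6) \<le> ereal_of_enat (sharp I T c)"
proof -
  obtain m where m: "6 * m + CARD('n) = CARD('n) ^ 3" "enat m \<le> sharp I T c"
    using sharp_lower_bound[OF convex t0] by blast
  have "6 * real m + real CARD('n) = real CARD('n) ^ 3"
    using arg_cong[OF m(1), of real] by simp
  then have "ereal ((real CARD('n) ^ 3 - real CARD('n)) / 6) = ereal_of_enat (enat m)" by simp
  also have "\<dots> \<le> ereal_of_enat (sharp I T c)" using m(2) by (simp only: ereal_of_enat_le_iff)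
  finally show ?thesis .
qed

theorem corollary2p16:
  assumes "CARD('n::finite) \<ge> 2"
  shows "(\<forall>\<gamma> :: complex \<Rightarrow> (real ^ 'n) set. convex_curve_circle \<gamma> \<longrightarrow>
            ereal_of_enat (sharp_circle \<gamma>) \<ge> ereal ((real CARD('n) ^ 3 - real CARD('n)) / 6)) \<and>
         (\<forall>(I :: real set) (\<gamma> :: real \<Rightarrow> (real ^ 'n) set).
            is_interval I \<and> (\<exists>a\<in>I. \<exists>b\<in>I. a < b) \<and> convex_curve_interval I \<gamma> \<longrightarrow>
            ereal_of_enat (sharp_interval I \<gamma>) \<ge> ereal ((real CARD('n) ^ 3 - real CARD('n)) / 6))"
proof (intro conjI allI impI)
  fix \<gamma> :: "complex \<Rightarrow> (real ^ 'n) set"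
  assume "convex_curve_circle \<gamma>"
  then show "ereal ((real CARD('n) ^ 3 - real CARD('n)) / 6) \<le> ereal_of_enat (sharp_circle \<gamma>)"
    unfolding convex_curve_circle_def sharp_circle_def
    by (rule sharp_ge_cubic[of _ _ _ 0 "2 * pi"]) auto
next
  fix I :: "real set" and \<gamma> :: "real \<Rightarrow> (real ^ 'n) set"
  assume I: "is_interval I \<and> (\<exists>a\<in>I. \<exists>b\<in>I. a < b) \<and> convex_curve_interval I \<gamma>"
  show "ereal ((real CARD('n) ^ 3 - real CARD('n)) / 6) \<le> ereal_of_enat (sharp_interval I \<gamma>)"
  proof -
    obtain a b where ab: "a \<in> I" "b \<in> I" "a < b" using I by blast
    have "{a<..<b} \<subseteq> I"
      using I ab unfolding is_interval_1 by (meson greaterThanLessThan_iff less_imp_le subsetI)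
    then have int: "{a<..<b} \<subseteq> interior I" by (rule interior_maximal) simp
    show ?thesis
      unfolding sharp_interval_def
    proof (rule sharp_ge_cubic[of _ _ _ "(a + b) / 2" "(b - a) / 2"])
      show "globally_convex I I \<gamma>" using I by (simp add: convex_curve_interval_def)
      have "{(a + b) / 2..<(a + b) / 2 + (b - a) / 2} \<subseteq> {a<..<b}"
        using ab(3) by (auto simp: field_simps)
      then show "{(a + b) / 2..<(a + b) / 2 + (b - a) / 2} \<subseteq> I \<inter> interior I"
        using int interior_subset[of I] by blast
    qed (use ab in simp)
  qed
qed

end
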